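(* Let $n\ge 3$ and let $G$ be either $\mathrm{IA}_n$ or $\mathrm{OA}_n$. Then $\mathrm{gr}_\Gamma(G)\otimes\mathbb{Q}$ is infinite-dimensional as a $\mathbb{Q}$-vector space, and $B(G)\otimes\mathbb{Q}$ has non-trivial $G_{\mathrm{ab}}$-action.
   Context: $F_n$ is the free group of rank $n$; $\mathrm{IA}_n=\ker(\mathrm{Aut}(F_n)\to\mathrm{GL}_n(\mathbb{Z}))$ is the group of automorphisms inducing the identity on the abelianization $\mathbb{Z}^n$, and $\mathrm{OA}_n=\mathrm{IA}_n/\mathrm{Inn}(F_n)=\ker(\mathrm{Out}(F_n)\to\mathrm{GL}_n(\mathbb{Z}))$. For a group $G$, $\mathrm{gr}_\Gamma(G)=\bigoplus_{s\ge1}\Gamma^s(G)/\Gamma^{s+1}(G)$, where $\Gamma^1(G)=G$, $\Gamma^{s+1}(G)=(\Gamma^s(G),G)$ is the lower central series. $B(G)=G'/G''=H_1(G',\mathbb{Z})$ is the Alexander invariant, a module over $\mathbb{Z}G_{\mathrm{ab}}$, $G_{\mathrm{ab}}=G/G'$, via $\bar h\cdot\bar g=\overline{hgh^{-1}}$ for $h\in G$, $g\in G'$; $B(G)\otimes\mathbb{Q}$ has the induced $\mathbb{Q}G_{\mathrm{ab}}$-module structure. The action is trivial if every element of $G_{\mathrm{ab}}$ acts as the identity. *)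

theory Defs
  imports
    "HOL-Algebra.Free_Abelian_Groups"
    "HOL-Algebra.Bij"
    "Jordan_Normal_Form.VS_Connect"
begin

text \<open>A letter \<open>(x, False)\<close> stands for the generator \<open>x\<close>, and \<open>(x, True)\<close> for its inverse.
  The elements of the free group are the reduced words.\<close>

type_synonym 'a word = "('a \<times> bool) list"

definition inv_letter :: "'a \<times> bool \<Rightarrow> 'a \<times> bool" where
  "inv_letter a = (fst a, \<not> snd a)"

fun reduced :: "'a word \<Rightarrow> bool" where
  "reduced [] \<longleftrightarrow> True"
| "reduced [a] \<longleftrightarrow> True"
| "reduced (a # b # w) \<longleftrightarrow> a \<noteq> inv_letter b \<and> reduced (b # w)"

definition push_letter :: "'a \<times> bool \<Rightarrow> 'a word \<Rightarrow> 'a word" where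
  "push_letter a w = (if w \<noteq> [] \<and> hd w = inv_letter a then tl w else a # w)"

definition free_group :: "'a set \<Rightarrow> 'a word monoid" where
  "free_group S = \<lparr>carrier = {w. reduced w \<and> fst ` set w \<subseteq> S},
     monoid.mult = (\<lambda>u v. foldr push_letter u v), one = []\<rparr>"

abbreviation FG :: "nat \<Rightarrow> nat word monoid" where
  "FG n \<equiv> free_group {..<n}"

lemma inv_letter_invol [simp]: "inv_letter (inv_letter a) = a"
  by (simp add: inv_letter_def)

lemma inv_letter_neq [simp]: "inv_letter a \<noteq> a" "a \<noteq> inv_letter a"
  by (auto simp: inv_letter_def prod_eq_iff)

lemma fst_inv_letter [simp]: "fst (inv_letter a) = fst a"
  by (simp add: inv_letter_def)

lemma reduced_Cons: "reduced (a # w) \<longleftrightarrow> reduced w \<and> (w \<noteq> [] \<longrightarrow> hd w \<noteq> inv_letter a)"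
proof (cases w)
  case (Cons b v)
  have "a = inv_letter b \<longleftrightarrow> b = inv_letter a"
    by (metis inv_letter_invol)
  with Cons show ?thesis by auto
qed auto

lemma reduced_push: "reduced w \<Longrightarrow> reduced (push_letter a w)"
  by (cases w) (auto simp: push_letter_def reduced_Cons)

lemma push_cancel: "reduced w \<Longrightarrow> push_letter a (push_letter (inv_letter a) w) = w"
  by (cases w) (auto simp: push_letter_def reduced_Cons)

lemma push_reduced: "reduced (a # w) \<Longrightarrow> push_letter a w = a # w"
  by (auto simp: push_letter_def reduced_Cons)

lemma reduced_foldr_push: "reduced v \<Longrightarrow> reduced (foldr push_letter u v)"
  by (induction u) (auto intro: reduced_push)

lemma letters_push: "fst ` set (push_letter a w) \<subseteq> insert (fst a) (fst ` set w)"
  by (cases w) (auto simp: push_letter_def)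

lemma letters_foldr_push: "fst ` set (foldr push_letter u v) \<subseteq> fst ` set u \<union> fst ` set v"
proof (induction u)
  case (Cons a u)
  have "fst ` set (foldr push_letter (a # u) v)
      \<subseteq> insert (fst a) (fst ` set (foldr push_letter u v))"
    using letters_push[of a "foldr push_letter u v"] by simp
  also have "\<dots> \<subseteq> insert (fst a) (fst ` set u \<union> fst ` set v)"
    using Cons.IH by (rule insert_mono)
  finally show ?case by simp
qed auto

lemma foldr_push_Nil: "reduced u \<Longrightarrow> foldr push_letter u [] = u"
  by (induction u) (auto simp: reduced_Cons push_letter_def)

lemma foldr_push_push:
  "reduced v \<Longrightarrow> reduced w \<Longrightarrow>
    foldr push_letter (push_letter a v) w = push_letter a (foldr push_letter v w)"
proof (cases "v \<noteq> [] \<and> hd v = inv_letter a")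
  case True
  assume w: "reduced w"
  from True obtain v' where v: "v = inv_letter a # v'" by (cases v) auto
  have "push_letter a v = v'" by (simp add: push_letter_def v)
  moreover have "foldr push_letter v w = push_letter (inv_letter a) (foldr push_letter v' w)"
    by (simp add: v)
  ultimately show ?thesis
    using push_cancel[OF reduced_foldr_push[OF w]] by simp
qed (auto simp: push_letter_def[of a v])

lemma foldr_push_assoc:
  "reduced v \<Longrightarrow> reduced w \<Longrightarrow>
    foldr push_letter (foldr push_letter u v) w = foldr push_letter u (foldr push_letter v w)"
  by (induction u) (auto simp: foldr_push_push reduced_foldr_push)

lemma foldr_push_inverse:
  "reduced u \<Longrightarrow> foldr push_letter (rev (map inv_letter u)) u = []"
proof (induction u)
  case (Cons a u)
  then show ?case
    by (auto simp: reduced_Cons push_letter_def)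
qed auto

lemma reduced_inverse_aux:
  "reduced u \<Longrightarrow> reduced (rev (map inv_letter u))"
proof (induction u)
  case (Cons a u)
  have *: "reduced (v @ [b]) \<longleftrightarrow> reduced v \<and> (v \<noteq> [] \<longrightarrow> last v \<noteq> inv_letter b)" for v b
    by (induction v) (auto simp: reduced_Cons hd_append)
  show ?case using Cons by (auto simp: * reduced_Cons last_rev hd_map)
qed auto

lemma group_free_group: "group (free_group S)"
proof (rule groupI)
  fix u assume u: "u \<in> carrier (free_group S)"
  have "set (map fst (rev (map inv_letter u))) = fst ` set u"
    by (auto simp: image_image)
  with u show "\<exists>v\<in>carrier (free_group S). v \<otimes>\<^bsub>free_group S\<^esub> u = \<one>\<^bsub>free_group S\<^esub>"
    by (intro bexI[of _ "rev (map inv_letter u)"])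
       (auto simp: free_group_def foldr_push_inverse reduced_inverse_aux)
next
  fix u v assume "u \<in> carrier (free_group S)" "v \<in> carrier (free_group S)"
  then show "u \<otimes>\<^bsub>free_group S\<^esub> v \<in> carrier (free_group S)"
    using order_trans[OF letters_foldr_push[of u v], of S]
    by (simp add: free_group_def reduced_foldr_push)
qed (auto simp: free_group_def foldr_push_assoc)

definition abelianization :: "('a, 'b) monoid_scheme \<Rightarrow> 'a set monoid" where
  "abelianization G = G Mod derived G (carrier G)"

lemma (in group) comm_group_abelianization: "comm_group (abelianization G)"
  unfolding abelianization_def by (rule derived_quot_is_comm_group)

definition induced_auto :: "('a, 'b) monoid_scheme \<Rightarrow> ('a \<Rightarrow> 'a) \<Rightarrow> ('a set \<Rightarrow> 'a set)" where
  "induced_auto G \<phi> = (\<lambda>C \<in> carrier (abelianization G). \<phi> ` C)"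

text \<open>\<open>GL n \<int>\<close> is the automorphism group of the abelianization of \<open>FG n\<close>, so that it appears
  here without a choice of coordinates.\<close>

definition IA :: "nat \<Rightarrow> (nat word \<Rightarrow> nat word) monoid" where
  "IA n = (AutoGroup (FG n))
     \<lparr>carrier := kernel (AutoGroup (FG n)) (AutoGroup (abelianization (FG n))) (induced_auto (FG n))\<rparr>"

definition conj_auto :: "('a, 'b) monoid_scheme \<Rightarrow> 'a \<Rightarrow> ('a \<Rightarrow> 'a)" where
  "conj_auto G g = (\<lambda>x \<in> carrier G. g \<otimes>\<^bsub>G\<^esub> x \<otimes>\<^bsub>G\<^esub> inv\<^bsub>G\<^esub> g)"

definition Inn :: "('a, 'b) monoid_scheme \<Rightarrow> ('a \<Rightarrow> 'a) set" where
  "Inn G = conj_auto G ` carrier G"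

definition OA :: "nat \<Rightarrow> (nat word \<Rightarrow> nat word) set monoid" where
  "OA n = IA n Mod Inn (FG n)"

lemma carrier_IA:
  "carrier (IA n) = {\<phi> \<in> auto (FG n). \<forall>C \<in> carrier (abelianization (FG n)). \<phi> ` C = C}"
proof -
  have "induced_auto (FG n) \<phi> = (\<lambda>C \<in> carrier (abelianization (FG n)). C) \<longleftrightarrow>
      (\<forall>C \<in> carrier (abelianization (FG n)). \<phi> ` C = C)" for \<phi>
    unfolding induced_auto_def by (auto simp: fun_eq_iff restrict_def)
  then show ?thesis
    by (simp add: IA_def kernel_def AutoGroup_def BijGroup_def)
qed

lemma subgroup_IA: "subgroup (carrier (IA n)) (AutoGroup (FG n))"
proof -
  interpret group "FG n" by (rule group_free_group)
  interpret A: group "AutoGroup (FG n)" by (rule AutoGroup)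
  let ?P = "\<lambda>\<phi>. \<forall>C \<in> carrier (abelianization (FG n)). \<phi> ` C = C"
  have sub: "C \<subseteq> carrier (FG n)" if "C \<in> carrier (abelianization (FG n))" for C
    using that subgroup.rcosets_carrier[OF derived_is_subgroup[OF subset_refl] group_axioms]
    by (simp add: abelianization_def FactGroup_def)
  have bij: "\<phi> \<in> Bij (carrier (FG n))" if "\<phi> \<in> auto (FG n)" for \<phi>
    using that by (simp add: auto_def)
  have carr: "carrier (AutoGroup (FG n)) = auto (FG n)"
    by (simp add: AutoGroup_def)
  have mult: "(\<phi> \<otimes>\<^bsub>AutoGroup (FG n)\<^esub> \<psi>) ` C = \<phi> ` \<psi> ` C"
    if "\<phi> \<in> auto (FG n)" "\<psi> \<in> auto (FG n)" "C \<subseteq> carrier (FG n)" for \<phi> \<psi> C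
    using bij[OF that(1)] bij[OF that(2)] that(3)
    by (simp add: AutoGroup_def BijGroup_def compose_def image_image subset_iff cong: image_cong)
  have one: "\<one>\<^bsub>AutoGroup (FG n)\<^esub> ` C = C" if "C \<subseteq> carrier (FG n)" for C
    using that by (auto simp: AutoGroup_def BijGroup_def subset_iff)
  show ?thesis
  proof (rule A.subgroupI)
    show "carrier (IA n) \<subseteq> carrier (AutoGroup (FG n))"
      by (auto simp: carrier_IA carr)
    show "carrier (IA n) \<noteq> {}"
      using A.one_closed one sub unfolding carrier_IA carr by blast
  next
    fix \<phi> assume \<phi>: "\<phi> \<in> carrier (IA n)"
    then have a: "\<phi> \<in> auto (FG n)" by (simp add: carrier_IA)
    let ?i = "inv\<^bsub>AutoGroup (FG n)\<^esub> \<phi>"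
    have i: "?i \<in> auto (FG n)" using A.inv_closed a by (simp add: carr)
    have "?i ` C = C" if C: "C \<in> carrier (abelianization (FG n))" for C
    proof -
      have "?i ` C = ?i ` \<phi> ` C" using \<phi> C by (simp add: carrier_IA)
      also have "\<dots> = (?i \<otimes>\<^bsub>AutoGroup (FG n)\<^esub> \<phi>) ` C" using mult[OF i a sub[OF C]] by simp
      also have "\<dots> = C" using A.l_inv a one[OF sub[OF C]] by (simp add: carr)
      finally show ?thesis .
    qed
    then show "?i \<in> carrier (IA n)" using i by (simp add: carrier_IA)
  next
    fix \<phi> \<psi> assume \<phi>: "\<phi> \<in> carrier (IA n)" and \<psi>: "\<psi> \<in> carrier (IA n)"
    have "\<phi> \<in> auto (FG n)" "\<psi> \<in> auto (FG n)"
      using \<phi> \<psi> by (simp_all add: carrier_IA)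
    then have "\<phi> \<otimes>\<^bsub>AutoGroup (FG n)\<^esub> \<psi> \<in> auto (FG n)"
      using A.m_closed[of \<phi> \<psi>] by (simp only: carr)
    then show "\<phi> \<otimes>\<^bsub>AutoGroup (FG n)\<^esub> \<psi> \<in> carrier (IA n)"
      using \<phi> \<psi> mult sub by (simp add: carrier_IA)
  qed
qed

lemma group_IA: "group (IA n)"
proof -
  have "IA n = (AutoGroup (FG n))\<lparr>carrier := carrier (IA n)\<rparr>"
    by (simp add: IA_def)
  then show ?thesis
    using group.subgroup_imp_group[OF group.AutoGroup[OF group_free_group] subgroup_IA] by metis
qed


lemma carrier_AutoGroup: "carrier (AutoGroup G) = auto G"
  by (simp add: AutoGroup_def)

lemma mult_AutoGroup:
  "\<phi> \<in> auto G \<Longrightarrow> \<psi> \<in> auto G \<Longrightarrow> \<phi> \<otimes>\<^bsub>AutoGroup G\<^esub> \<psi> = (\<lambda>x \<in> carrier G. \<phi> (\<psi> x))"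
  by (simp add: AutoGroup_def BijGroup_def auto_def compose_def)

lemma (in group) conj_auto_compose:
  assumes "g \<in> carrier G" "h \<in> carrier G" "x \<in> carrier G"
  shows "conj_auto G g (conj_auto G h x) = conj_auto G (g \<otimes> h) x"
  using assms by (simp add: conj_auto_def m_assoc inv_mult_group)

lemma (in group) conj_auto_one: "x \<in> carrier G \<Longrightarrow> conj_auto G \<one> x = x"
  by (simp add: conj_auto_def)

lemma (in group) conj_auto_closed:
  "g \<in> carrier G \<Longrightarrow> x \<in> carrier G \<Longrightarrow> conj_auto G g x \<in> carrier G"
  by (simp add: conj_auto_def)

lemma (in group) conj_auto_in_auto:
  assumes g: "g \<in> carrier G" shows "conj_auto G g \<in> auto G"
proof -
  have *: "inv g \<otimes> (g \<otimes> x) = x" if "x \<in> carrier G" for x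
    using that g by (simp add: m_assoc[symmetric])
  have "conj_auto G g \<in> hom G G"
    using g by (auto simp: hom_def conj_auto_def m_assoc *)
  moreover have "bij_betw (conj_auto G g) (carrier G) (carrier G)"
    by (rule bij_betw_byWitness[where f' = "conj_auto G (inv g)"])
       (use g in \<open>auto simp: conj_auto_compose conj_auto_one conj_auto_closed\<close>)
  ultimately show ?thesis
    by (simp add: auto_def Bij_def conj_auto_def)
qed

lemma (in group) Inn_normal: "Inn G \<lhd> AutoGroup G"
proof -
  interpret A: group "AutoGroup G" by (rule AutoGroup)
  have Inn: "Inn G = conj_auto G ` carrier G"
    by (simp add: Inn_def conj_auto_def)
  have hom: "conj_auto G \<in> hom G (AutoGroup G)"
  proof (rule homI)
    show "conj_auto G g \<in> carrier (AutoGroup G)" if "g \<in> carrier G" for g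
      using that by (simp add: carrier_AutoGroup conj_auto_in_auto)
    show "conj_auto G (g \<otimes> h) = conj_auto G g \<otimes>\<^bsub>AutoGroup G\<^esub> conj_auto G h"
      if gh: "g \<in> carrier G" "h \<in> carrier G" for g h
    proof
      fix x
      show "conj_auto G (g \<otimes> h) x = (conj_auto G g \<otimes>\<^bsub>AutoGroup G\<^esub> conj_auto G h) x"
      proof (cases "x \<in> carrier G")
        case True
        then show ?thesis
          using gh by (simp add: mult_AutoGroup conj_auto_in_auto conj_auto_compose)
      next
        case False
        then show ?thesis
          using gh by (simp add: mult_AutoGroup conj_auto_in_auto) (simp add: conj_auto_def)
      qed
    qed
  qed
  have sub: "subgroup (Inn G) (AutoGroup G)"
    unfolding Inn using group_hom.img_is_subgroup[of G "AutoGroup G" "conj_auto G"] hom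
    by (simp add: group_hom_def group_hom_axioms_def group_axioms A.group_axioms)
  show ?thesis
  proof (rule A.normal_invI[OF sub])
    fix \<phi> \<psi> assume \<phi>: "\<phi> \<in> carrier (AutoGroup G)" and "\<psi> \<in> Inn G"
    then obtain g where g: "g \<in> carrier G" and \<psi>: "\<psi> = conj_auto G g" by (auto simp: Inn)
    have a: "\<phi> \<in> auto G" using \<phi> by (simp add: carrier_AutoGroup)
    then interpret h: group_hom G G \<phi>
      by unfold_locales (simp add: auto_def)
    have "\<phi> \<otimes>\<^bsub>AutoGroup G\<^esub> \<psi> = conj_auto G (\<phi> g) \<otimes>\<^bsub>AutoGroup G\<^esub> \<phi>"
      unfolding \<psi> mult_AutoGroup[OF a conj_auto_in_auto[OF g]]
        mult_AutoGroup[OF conj_auto_in_auto[OF h.hom_closed[OF g]] a]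
      using g by (intro restrict_ext) (simp add: conj_auto_def)
    moreover have c: "conj_auto G (\<phi> g) \<in> carrier (AutoGroup G)"
      using g by (simp add: carrier_AutoGroup conj_auto_in_auto)
    ultimately have "\<phi> \<otimes>\<^bsub>AutoGroup G\<^esub> \<psi> \<otimes>\<^bsub>AutoGroup G\<^esub> inv\<^bsub>AutoGroup G\<^esub> \<phi> = conj_auto G (\<phi> g)"
      using \<phi> by (simp add: A.m_assoc)
    then show "\<phi> \<otimes>\<^bsub>AutoGroup G\<^esub> \<psi> \<otimes>\<^bsub>AutoGroup G\<^esub> inv\<^bsub>AutoGroup G\<^esub> \<phi> \<in> Inn G"
      using g by (simp add: Inn)
  qed
qed

lemma (in group) conj_auto_image_subset:
  assumes g: "g \<in> carrier G" and C: "C \<in> carrier (abelianization G)"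
  shows "conj_auto G g ` C \<subseteq> C"
proof
  fix y assume "y \<in> conj_auto G g ` C"
  moreover obtain x where x: "x \<in> carrier G" "C = derived G (carrier G) #> x"
    using C by (auto simp: abelianization_def FactGroup_def RCOSETS_def)
  moreover have sub: "subgroup (derived G (carrier G)) G"
    by (intro derived_is_subgroup subset_refl)
  ultimately obtain k where k: "k \<in> derived G (carrier G)" and y: "y = conj_auto G g (k \<otimes> x)"
    unfolding r_coset_def by auto
  have kc: "k \<in> carrier G" using subgroup.mem_carrier[OF sub k] .
  define z where "z = k \<otimes> x"
  have z: "z \<in> carrier G" using kc x by (simp add: z_def)
  have c: "g \<otimes> z \<otimes> inv g \<otimes> inv z \<in> derived G (carrier G)"
    unfolding derived_def using g z by (intro generate.incl) blast
  have "y = g \<otimes> z \<otimes> inv g \<otimes> inv z \<otimes> z"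
    using g z by (simp add: y z_def[symmetric] conj_auto_def m_assoc)
  also have "\<dots> = (g \<otimes> z \<otimes> inv g \<otimes> inv z \<otimes> k) \<otimes> x"
    using g kc x by (simp add: z_def m_assoc)
  finally show "y \<in> C"
    using subgroup.m_closed[OF sub c k] unfolding x(2) r_coset_def by blast
qed

lemma Inn_subset_IA: "Inn (FG n) \<subseteq> carrier (IA n)"
proof
  interpret group "FG n" by (rule group_free_group)
  fix \<phi> assume "\<phi> \<in> Inn (FG n)"
  then obtain g where g: "g \<in> carrier (FG n)" and \<phi>: "\<phi> = conj_auto (FG n) g"
    by (auto simp: Inn_def conj_auto_def)
  have "\<phi> ` C = C" if C: "C \<in> carrier (abelianization (FG n))" for C
  proof
    show "\<phi> ` C \<subseteq> C" unfolding \<phi> by (rule conj_auto_image_subset[OF g C])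
    show "C \<subseteq> \<phi> ` C"
    proof
      fix x assume x: "x \<in> C"
      then have xc: "x \<in> carrier (FG n)"
        using C subgroup.rcosets_carrier[OF derived_is_subgroup[OF subset_refl] group_axioms]
        by (auto simp: abelianization_def FactGroup_def)
      have "conj_auto (FG n) (inv\<^bsub>FG n\<^esub> g) x \<in> C"
        using conj_auto_image_subset[OF inv_closed[OF g] C] x by blast
      moreover have "x = \<phi> (conj_auto (FG n) (inv\<^bsub>FG n\<^esub> g) x)"
        using g xc by (simp add: \<phi> conj_auto_compose conj_auto_one)
      ultimately show "x \<in> \<phi> ` C" by blast
    qed
  qed
  then show "\<phi> \<in> carrier (IA n)"
    using conj_auto_in_auto[OF g] by (simp add: carrier_IA \<phi>)
qed

lemma group_OA: "group (OA n)"
proof -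
  have "IA n = (AutoGroup (FG n))\<lparr>carrier := carrier (IA n)\<rparr>"
    by (simp add: IA_def)
  moreover have "Inn (FG n) \<lhd> (AutoGroup (FG n))\<lparr>carrier := carrier (IA n)\<rparr>"
    by (intro group.normal_restrict_supergroup group.AutoGroup group.Inn_normal
        group_free_group subgroup_IA Inn_subset_IA)
  ultimately show ?thesis
    unfolding OA_def by (metis normal.factorgroup_is_group)
qed

text \<open>The series is indexed from \<open>1\<close>; the value at \<open>0\<close> is a dummy.\<close>

fun lower_central :: "('a, 'b) monoid_scheme \<Rightarrow> nat \<Rightarrow> 'a set" where
  "lower_central G 0 = carrier G"
| "lower_central G (Suc 0) = carrier G"
| "lower_central G (Suc (Suc s)) = generate G
     (\<Union>x \<in> lower_central G (Suc s). \<Union>y \<in> carrier G. {x \<otimes>\<^bsub>G\<^esub> y \<otimes>\<^bsub>G\<^esub> inv\<^bsub>G\<^esub> x \<otimes>\<^bsub>G\<^esub> inv\<^bsub>G\<^esub> y})"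

definition gr_lcs :: "('a, 'b) monoid_scheme \<Rightarrow> (nat \<Rightarrow> 'a set) monoid" where
  "gr_lcs G = sum_group {1..}
     (\<lambda>s. G\<lparr>carrier := lower_central G s\<rparr> Mod lower_central G (Suc s))"

lemma (in group) lower_central_normal: "lower_central G (Suc s) \<lhd> G"
proof (induction s)
  case (Suc s)
  let ?L = "lower_central G (Suc s)"
  let ?C = "\<Union>x \<in> ?L. \<Union>y \<in> carrier G. {x \<otimes> y \<otimes> inv x \<otimes> inv y}"
  interpret L: normal ?L G by (rule Suc.IH)
  have "generate G ?C \<lhd> G"
  proof (rule normal_generateI)
    show "?C \<subseteq> carrier G" using L.subset by (auto simp: subset_iff)
  next
    fix c g assume "c \<in> ?C" and g: "g \<in> carrier G"
    then obtain x y where xy: "x \<in> ?L" "y \<in> carrier G" and c: "c = x \<otimes> y \<otimes> inv x \<otimes> inv y"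
      by auto
    have x: "x \<in> carrier G" using xy(1) L.subset by blast
    have *: "inv g \<otimes> (g \<otimes> b) = b" if "b \<in> carrier G" for b
      using that g by (simp add: m_assoc[symmetric])
    let ?x = "g \<otimes> x \<otimes> inv g" and ?y = "g \<otimes> y \<otimes> inv g"
    have "g \<otimes> c \<otimes> inv g = ?x \<otimes> ?y \<otimes> inv ?x \<otimes> inv ?y"
      unfolding c using x xy(2) g by (simp add: m_assoc inv_mult_group *)
    moreover have "?x \<in> ?L" by (rule L.inv_op_closed2[OF g xy(1)])
    moreover have "?y \<in> carrier G" using xy(2) g by simp
    ultimately show "g \<otimes> c \<otimes> inv g \<in> ?C" by blast
  qed
  then show ?case by simp
qed (simp add: normal_self)

lemma (in group) lower_central_decreasing:
  "lower_central G (Suc (Suc s)) \<subseteq> lower_central G (Suc s)"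
proof -
  interpret L: normal "lower_central G (Suc s)" G by (rule lower_central_normal)
  have "x \<otimes> y \<otimes> inv x \<otimes> inv y \<in> lower_central G (Suc s)"
    if x: "x \<in> lower_central G (Suc s)" and y: "y \<in> carrier G" for x y
  proof -
    have "x \<otimes> (y \<otimes> inv x \<otimes> inv y) \<in> lower_central G (Suc s)"
      by (intro L.m_closed x L.inv_op_closed2 y L.m_inv_closed)
    moreover have "x \<otimes> y \<otimes> inv x \<otimes> inv y = x \<otimes> (y \<otimes> inv x \<otimes> inv y)"
      using x y L.subset by (simp add: m_assoc subset_iff)
    ultimately show ?thesis by metis
  qed
  then show ?thesis
    unfolding lower_central.simps(3)
    by (intro generate_subgroup_incl L.subgroup_axioms) blast
qed

lemma (in group) mult_eq_commutator_mult:
  assumes "x \<in> carrier G" "y \<in> carrier G"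
  shows "x \<otimes> y = (x \<otimes> y \<otimes> inv x \<otimes> inv y) \<otimes> (y \<otimes> x)"
proof -
  have "inv y \<otimes> (y \<otimes> x) = x" using assms by (simp add: m_assoc[symmetric])
  then show ?thesis using assms by (simp add: m_assoc)
qed

lemma (in group) comm_group_lower_central_factor:
  "comm_group (G\<lparr>carrier := lower_central G (Suc s)\<rparr> Mod lower_central G (Suc (Suc s)))"
proof -
  let ?L = "lower_central G (Suc s)" and ?M = "lower_central G (Suc (Suc s))"
  interpret L: normal ?L G by (rule lower_central_normal)
  interpret M: normal ?M G by (rule lower_central_normal)
  interpret K: group "G\<lparr>carrier := ?L\<rparr>"
    by (rule subgroup_imp_group[OF L.subgroup_axioms])
  interpret N: normal ?M "G\<lparr>carrier := ?L\<rparr>"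
    by (rule normal_restrict_supergroup[OF L.subgroup_axioms M.normal_axioms lower_central_decreasing])
  show ?thesis
  proof (rule group.group_comm_groupI[OF N.factorgroup_is_group])
    fix X Y assume "X \<in> carrier (G\<lparr>carrier := ?L\<rparr> Mod ?M)" "Y \<in> carrier (G\<lparr>carrier := ?L\<rparr> Mod ?M)"
    then obtain x y where x: "x \<in> ?L" "X = ?M #> x" and y: "y \<in> ?L" "Y = ?M #> y"
      by (auto simp: FactGroup_def RCOSETS_def r_coset_def)
    have c: "x \<in> carrier G" "y \<in> carrier G" using x(1) y(1) L.subset by blast+
    have "x \<otimes> y \<otimes> inv x \<otimes> inv y \<in> ?M"
      unfolding lower_central.simps(3) using x(1) c by (intro generate.incl) blast
    moreover have "x \<otimes> y = (x \<otimes> y \<otimes> inv x \<otimes> inv y) \<otimes> (y \<otimes> x)"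
      by (rule mult_eq_commutator_mult[OF c])
    ultimately have "x \<otimes> y \<in> ?M #> (y \<otimes> x)"
      unfolding r_coset_def by blast
    then have "?M #> (y \<otimes> x) = ?M #> (x \<otimes> y)"
      using c by (intro repr_independence M.subgroup_axioms) auto
    then have "X <#> Y = Y <#> X"
      using M.rcos_sum c x(2) y(2) by metis
    then show "X \<otimes>\<^bsub>G\<lparr>carrier := ?L\<rparr> Mod ?M\<^esub> Y = Y \<otimes>\<^bsub>G\<lparr>carrier := ?L\<rparr> Mod ?M\<^esub> X"
      by (simp add: FactGroup_def set_mult_def)
  qed
qed

lemma (in group) comm_group_gr_lcs: "comm_group (gr_lcs G)"
proof -
  let ?Q = "\<lambda>s. G\<lparr>carrier := lower_central G s\<rparr> Mod lower_central G (Suc s)"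
  have Q: "comm_group (?Q s)" if "s \<in> {1..}" for s
    using comm_group_lower_central_factor[of "s - 1"] that by (cases s) auto
  then have grp: "group (?Q s)" if "s \<in> {1..}" for s
    using that comm_group.axioms(2) by blast
  show ?thesis
    unfolding gr_lcs_def
  proof (rule group.group_comm_groupI)
    show "group (sum_group {1..} ?Q)" by (intro sum_group grp)
    fix x y assume "x \<in> carrier (sum_group {1..} ?Q)" "y \<in> carrier (sum_group {1..} ?Q)"
    then have "x s \<in> carrier (?Q s)" "y s \<in> carrier (?Q s)" if "s \<in> {1..}" for s
      using that by (auto simp only: carrier_sum_group[OF grp] mem_Collect_eq PiE_iff)
    then have "x s \<otimes>\<^bsub>?Q s\<^esub> y s = y s \<otimes>\<^bsub>?Q s\<^esub> x s" if "s \<in> {1..}" for s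
      using that comm_monoid.m_comm[OF comm_group.axioms(1)[OF Q]] by blast
    then show "x \<otimes>\<^bsub>sum_group {1..} ?Q\<^esub> y = y \<otimes>\<^bsub>sum_group {1..} ?Q\<^esub> x"
      unfolding mult_sum_group by (intro restrict_ext)
  qed
qed

definition tensor_relations ::
  "('a, 'c) monoid_scheme \<Rightarrow> ('b, 'd) monoid_scheme \<Rightarrow> ('a \<times> 'b \<Rightarrow>\<^sub>0 int) set" where
  "tensor_relations A B =
     {frag_of (a \<otimes>\<^bsub>A\<^esub> a', b) - frag_of (a, b) - frag_of (a', b) | a a' b.
        a \<in> carrier A \<and> a' \<in> carrier A \<and> b \<in> carrier B} \<union>
     {frag_of (a, b \<otimes>\<^bsub>B\<^esub> b') - frag_of (a, b) - frag_of (a, b') | a b b'.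
        a \<in> carrier A \<and> b \<in> carrier B \<and> b' \<in> carrier B}"

definition tensor_kernel ::
  "('a, 'c) monoid_scheme \<Rightarrow> ('b, 'd) monoid_scheme \<Rightarrow> ('a \<times> 'b \<Rightarrow>\<^sub>0 int) set" where
  "tensor_kernel A B =
     generate (free_Abelian_group (carrier A \<times> carrier B)) (tensor_relations A B)"

definition tensor_product ::
  "('a, 'c) monoid_scheme \<Rightarrow> ('b, 'd) monoid_scheme \<Rightarrow> ('a \<times> 'b \<Rightarrow>\<^sub>0 int) set monoid" where
  "tensor_product A B = free_Abelian_group (carrier A \<times> carrier B) Mod tensor_kernel A B"

definition tensor_pure ::
  "('a, 'c) monoid_scheme \<Rightarrow> ('b, 'd) monoid_scheme \<Rightarrow> 'a \<Rightarrow> 'b \<Rightarrow> ('a \<times> 'b \<Rightarrow>\<^sub>0 int) set" where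
  "tensor_pure A B a b =
     tensor_kernel A B #>\<^bsub>free_Abelian_group (carrier A \<times> carrier B)\<^esub> frag_of (a, b)"

text \<open>The endomorphism \<open>f \<otimes> g\<close> of \<open>A \<otimes> B\<close>, for endomorphisms \<open>f\<close> of \<open>A\<close> and \<open>g\<close> of \<open>B\<close>.
  The map of free abelian groups need not send a coset onto a coset (it does not for \<open>g = 0\<close>),
  so the image is multiplied by the relation subgroup.\<close>

definition tensor_map ::
  "('a, 'c) monoid_scheme \<Rightarrow> ('b, 'd) monoid_scheme \<Rightarrow> ('a \<Rightarrow> 'a) \<Rightarrow> ('b \<Rightarrow> 'b) \<Rightarrow>
     ('a \<times> 'b \<Rightarrow>\<^sub>0 int) set \<Rightarrow> ('a \<times> 'b \<Rightarrow>\<^sub>0 int) set" where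
  "tensor_map A B f g C =
     tensor_kernel A B <#>\<^bsub>free_Abelian_group (carrier A \<times> carrier B)\<^esub>
       (frag_extend (\<lambda>(a, b). frag_of (f a, g b)) ` C)"

definition rat_group :: "rat monoid" where
  "rat_group = \<lparr>carrier = UNIV, monoid.mult = (+), one = 0\<rparr>"

text \<open>\<open>A \<otimes> \<rat>\<close> as a rational vector space. The fields \<open>mult\<close> and \<open>one\<close> of the record
  play no role for a module.\<close>

definition rationalization ::
  "('a, 'c) monoid_scheme \<Rightarrow> (rat, ('a \<times> rat \<Rightarrow>\<^sub>0 int) set) module" where
  "rationalization A =
     \<lparr>carrier = carrier (tensor_product A rat_group),
      monoid.mult = undefined, one = undefined,
      zero = \<one>\<^bsub>tensor_product A rat_group\<^esub>,
      add = (\<otimes>\<^bsub>tensor_product A rat_group\<^esub>),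
      module.smult = (\<lambda>q. tensor_map A rat_group (\<lambda>a. a) (\<lambda>r. q * r))\<rparr>"

lemma tensor_relations_in_carrier:
  assumes "comm_group A" "comm_group B"
  shows "tensor_relations A B \<subseteq> carrier (free_Abelian_group (carrier A \<times> carrier B))"
proof -
  interpret A: comm_group A by fact
  interpret B: comm_group B by fact
  have "Poly_Mapping.keys (frag_of x - frag_of y - frag_of z) \<subseteq> {x, y, z}"
    for x y z :: "'a \<times> 'c"
    using keys_diff[of "frag_of x - frag_of y" "frag_of z"] keys_diff[of "frag_of x" "frag_of y"]
    by auto
  then show ?thesis
    unfolding tensor_relations_def by (fastforce dest: subsetD)
qed

lemma tensor_kernel_normal:
  assumes "comm_group A" "comm_group B"
  shows "tensor_kernel A B \<lhd> free_Abelian_group (carrier A \<times> carrier B)"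
  unfolding tensor_kernel_def
  by (intro comm_group.subgroup_imp_normal abelian_free_Abelian_group
      group.generate_is_subgroup group_free_Abelian_group tensor_relations_in_carrier assms)

lemma comm_group_tensor_product:
  assumes "comm_group A" "comm_group B"
  shows "comm_group (tensor_product A B)"
  unfolding tensor_product_def
  using comm_group.abelian_FactGroup[OF abelian_free_Abelian_group]
    normal_imp_subgroup[OF tensor_kernel_normal[OF assms]] by blast

lemma tensor_kernel_diff:
  assumes "comm_group A" "comm_group B" "x \<in> tensor_kernel A B" "y \<in> tensor_kernel A B"
  shows "x - y \<in> tensor_kernel A B"
proof -
  have N: "subgroup (tensor_kernel A B) (free_Abelian_group (carrier A \<times> carrier B))"
    by (intro normal_imp_subgroup tensor_kernel_normal assms(1,2))
  show ?thesis
    using subgroup.m_closed[OF N assms(3) subgroup.m_inv_closed[OF N assms(4)]]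
      subgroup.mem_carrier[OF N assms(4)] by simp
qed

lemma tensor_kernel_0: "0 \<in> tensor_kernel A B"
  unfolding tensor_kernel_def by (metis generate.one one_free_Abelian_group)

lemma tensor_kernel_add:
  assumes "comm_group A" "comm_group B" "x \<in> tensor_kernel A B" "y \<in> tensor_kernel A B"
  shows "x + y \<in> tensor_kernel A B"
  using tensor_kernel_diff[OF assms(1,2) assms(3)
      tensor_kernel_diff[OF assms(1,2) tensor_kernel_0 assms(4)]] by simp

lemma frag_extend_tensor_kernel:
  assumes A: "comm_group A" and B: "comm_group B" and f: "f \<in> hom A A" and g: "g \<in> hom B B"
    and x: "x \<in> tensor_kernel A B"
  shows "frag_extend (\<lambda>(a, b). frag_of (f a, g b)) x \<in> tensor_kernel A B"
proof -
  have rel: "frag_extend (\<lambda>(a, b). frag_of (f a, g b)) h \<in> tensor_kernel A B"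
    if "h \<in> tensor_relations A B" for h
  proof -
    have "frag_extend (\<lambda>(a, b). frag_of (f a, g b)) h \<in> tensor_relations A B"
      using that unfolding tensor_relations_def
    proof (elim UnE CollectE exE conjE)
      fix a a' b
      assume "h = frag_of (a \<otimes>\<^bsub>A\<^esub> a', b) - frag_of (a, b) - frag_of (a', b)"
        "a \<in> carrier A" "a' \<in> carrier A" "b \<in> carrier B"
      then show "frag_extend (\<lambda>(a, b). frag_of (f a, g b)) h \<in>
        {frag_of (a \<otimes>\<^bsub>A\<^esub> a', b) - frag_of (a, b) - frag_of (a', b) | a a' b.
        a \<in> carrier A \<and> a' \<in> carrier A \<and> b \<in> carrier B} \<union>
        {frag_of (a, b \<otimes>\<^bsub>B\<^esub> b') - frag_of (a, b) - frag_of (a, b') | a b b'.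
        a \<in> carrier A \<and> b \<in> carrier B \<and> b' \<in> carrier B}"
        using hom_in_carrier[OF f] hom_in_carrier[OF g]
        by (intro UnI1 CollectI exI[of _ "f a"] exI[of _ "f a'"] exI[of _ "g b"])
           (simp add: frag_extend_diff hom_mult[OF f])
    next
      fix a b b'
      assume "h = frag_of (a, b \<otimes>\<^bsub>B\<^esub> b') - frag_of (a, b) - frag_of (a, b')"
        "a \<in> carrier A" "b \<in> carrier B" "b' \<in> carrier B"
      then show "frag_extend (\<lambda>(a, b). frag_of (f a, g b)) h \<in>
        {frag_of (a \<otimes>\<^bsub>A\<^esub> a', b) - frag_of (a, b) - frag_of (a', b) | a a' b.
        a \<in> carrier A \<and> a' \<in> carrier A \<and> b \<in> carrier B} \<union>
        {frag_of (a, b \<otimes>\<^bsub>B\<^esub> b') - frag_of (a, b) - frag_of (a, b') | a b b'.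
        a \<in> carrier A \<and> b \<in> carrier B \<and> b' \<in> carrier B}"
        using hom_in_carrier[OF f] hom_in_carrier[OF g]
        by (intro UnI2 CollectI exI[of _ "f a"] exI[of _ "g b"] exI[of _ "g b'"])
           (simp add: frag_extend_diff hom_mult[OF g])
    qed
    then show ?thesis
      unfolding tensor_kernel_def by (rule generate.incl)
  qed
  show ?thesis
    using x unfolding tensor_kernel_def[of A B]
  proof (induction rule: generate.induct)
    case (inv h)
    then have "inv\<^bsub>free_Abelian_group (carrier A \<times> carrier B)\<^esub> h = 0 - h"
      using tensor_relations_in_carrier[OF A B] by (auto simp: subset_iff)
    then show ?case
      using tensor_kernel_diff[OF A B tensor_kernel_0 rel[OF inv]]
      unfolding tensor_kernel_def by (simp add: frag_extend_minus)
  next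
    case (eng h1 h2)
    then show ?case
      using tensor_kernel_add[OF A B] unfolding tensor_kernel_def by (simp add: frag_extend_add)
  qed (use rel tensor_kernel_0 in \<open>auto simp: tensor_kernel_def\<close>)
qed

lemma keys_frag_extend_pair:
  assumes "f \<in> hom A A" "g \<in> hom B B" "Poly_Mapping.keys x \<subseteq> carrier A \<times> carrier B"
  shows "Poly_Mapping.keys (frag_extend (\<lambda>(a, b). frag_of (f a, g b)) x) \<subseteq> carrier A \<times> carrier B"
proof -
  have "Poly_Mapping.keys ((\<lambda>(a, b). frag_of (f a, g b)) z) \<subseteq> carrier A \<times> carrier B"
    if "z \<in> Poly_Mapping.keys x" for z
    using subsetD[OF assms(3) that] hom_in_carrier[OF assms(1)] hom_in_carrier[OF assms(2)]
    by auto
  then show ?thesis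
    by (intro order_trans[OF keys_frag_extend] UN_least)
qed

lemma tensor_map_coset:
  assumes A: "comm_group A" and B: "comm_group B" and f: "f \<in> hom A A" and g: "g \<in> hom B B"
  shows "tensor_map A B f g (tensor_kernel A B #>\<^bsub>free_Abelian_group (carrier A \<times> carrier B)\<^esub> x) =
    tensor_kernel A B #>\<^bsub>free_Abelian_group (carrier A \<times> carrier B)\<^esub>
      frag_extend (\<lambda>(a, b). frag_of (f a, g b)) x" (is "?L = ?R")
proof (intro equalityI subsetI)
  let ?\<phi> = "frag_extend (\<lambda>(a, b). frag_of (f a, g b))"
  fix y assume "y \<in> ?L"
  then obtain k n where kn: "k \<in> tensor_kernel A B" "n \<in> tensor_kernel A B" "y = k + ?\<phi> (n + x)"
    unfolding tensor_map_def set_mult_def r_coset_def by auto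
  then have "k + ?\<phi> n \<in> tensor_kernel A B"
    by (intro tensor_kernel_add[OF A B] frag_extend_tensor_kernel[OF A B f g])
  moreover have "y = (k + ?\<phi> n) + ?\<phi> x"
    using kn by (simp add: frag_extend_add add.assoc)
  ultimately show "y \<in> ?R"
    unfolding r_coset_def by auto
next
  let ?\<phi> = "frag_extend (\<lambda>(a, b). frag_of (f a, g b))"
  fix y assume "y \<in> ?R"
  then obtain k where "k \<in> tensor_kernel A B" "y = k + ?\<phi> x"
    unfolding r_coset_def by auto
  moreover have "0 + x \<in> tensor_kernel A B #>\<^bsub>free_Abelian_group (carrier A \<times> carrier B)\<^esub> x"
    unfolding r_coset_def using tensor_kernel_0 by auto
  ultimately show "y \<in> ?L"
    unfolding tensor_map_def set_mult_def by auto
qed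

lemma tensor_map_pure:
  assumes "comm_group A" "comm_group B" "f \<in> hom A A" "g \<in> hom B B"
  shows "tensor_map A B f g (tensor_pure A B a b) = tensor_pure A B (f a) (g b)"
  unfolding tensor_pure_def by (simp add: tensor_map_coset[OF assms])

lemma comm_group_rat_group: "comm_group rat_group"
proof (rule comm_groupI)
  show "\<exists>y\<in>carrier rat_group. y \<otimes>\<^bsub>rat_group\<^esub> x = \<one>\<^bsub>rat_group\<^esub>" for x
    by (rule bexI[of _ "- x"]) (auto simp: rat_group_def)
qed (auto simp: rat_group_def)

lemma tensor_coset_eqI:
  assumes A: "comm_group A" and B: "comm_group B"
    and "x - y \<in> tensor_kernel A B"
  shows "tensor_kernel A B #>\<^bsub>free_Abelian_group (carrier A \<times> carrier B)\<^esub> x =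
    tensor_kernel A B #>\<^bsub>free_Abelian_group (carrier A \<times> carrier B)\<^esub> y"
proof -
  let ?c = "\<lambda>z. tensor_kernel A B #>\<^bsub>free_Abelian_group (carrier A \<times> carrier B)\<^esub> z"
  have sub: "?c u \<subseteq> ?c v" if "u - v \<in> tensor_kernel A B" for u v
  proof
    fix z assume "z \<in> ?c u"
    then obtain k where k: "k \<in> tensor_kernel A B" "z = k + u"
      unfolding r_coset_def by auto
    then have "k + (u - v) \<in> tensor_kernel A B" "z = (k + (u - v)) + v"
      using tensor_kernel_add[OF A B _ that] by auto
    then show "z \<in> ?c v"
      unfolding r_coset_def mult_free_Abelian_group by blast
  qed
  have "y - x \<in> tensor_kernel A B"
    using tensor_kernel_diff[OF A B tensor_kernel_0 assms(3)] by simp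
  with sub assms(3) show ?thesis by blast
qed

lemma vectorspace_rationalization:
  assumes A: "comm_group A"
  shows "vectorspace class_ring (rationalization A)"
proof -
  let ?FA = "free_Abelian_group (carrier A \<times> carrier rat_group)"
  let ?N = "tensor_kernel A rat_group"
  let ?\<phi> = "\<lambda>q::rat. frag_extend (\<lambda>(a, r). frag_of (a, q * r))"
  note B = comm_group_rat_group
  interpret N: normal ?N ?FA
    by (rule tensor_kernel_normal[OF A B])
  interpret T: comm_group "tensor_product A rat_group"
    by (rule comm_group_tensor_product[OF A B])
  have id: "(\<lambda>a. a) \<in> hom A A"
    by (auto simp: hom_def)
  have sc: "(\<lambda>r. q * r) \<in> hom rat_group rat_group" for q
    by (auto simp: hom_def rat_group_def distrib_left)
  have smult: "q \<odot>\<^bsub>rationalization A\<^esub> (?N #>\<^bsub>?FA\<^esub> x) = ?N #>\<^bsub>?FA\<^esub> ?\<phi> q x" for q x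
    by (simp add: rationalization_def tensor_map_coset[OF A B id sc])
  have carr: "carrier (rationalization A) = (\<Union>x \<in> carrier ?FA. {?N #>\<^bsub>?FA\<^esub> x})"
    by (simp add: rationalization_def tensor_product_def FactGroup_def RCOSETS_def)
  have add: "(?N #>\<^bsub>?FA\<^esub> x) \<oplus>\<^bsub>rationalization A\<^esub> (?N #>\<^bsub>?FA\<^esub> y) = ?N #>\<^bsub>?FA\<^esub> (x + y)"
    if "x \<in> carrier ?FA" "y \<in> carrier ?FA" for x y
    using N.rcos_sum[OF that] by (simp add: rationalization_def tensor_product_def FactGroup_def)
  have keys: "?\<phi> q x \<in> carrier ?FA" if "x \<in> carrier ?FA" for q x
    using keys_frag_extend_pair[OF id sc] that by simp
  have closed: "x + y \<in> carrier ?FA" if "x \<in> carrier ?FA" "y \<in> carrier ?FA" for x y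
    using N.m_closed that by (metis mult_free_Abelian_group group.is_monoid group_free_Abelian_group monoid.m_closed)
  have distr: "?\<phi> (p + q) x - (?\<phi> p x + ?\<phi> q x) \<in> ?N" if "x \<in> carrier ?FA" for p q x
  proof -
    have "Poly_Mapping.keys x \<subseteq> carrier A \<times> carrier rat_group" using that by simp
    then show ?thesis
    proof (induction x rule: frag_induction)
      case zero
      then show ?case by (simp add: tensor_kernel_0)
    next
      case (one z)
      obtain a r where z: "z = (a, r)" by (cases z)
      with one have "frag_of (a, (p * r) \<otimes>\<^bsub>rat_group\<^esub> (q * r)) - frag_of (a, p * r) - frag_of (a, q * r)
          \<in> tensor_relations A rat_group"
        unfolding tensor_relations_def by (intro UnI2) (force simp: rat_group_def)
      then show ?case
        using generate.incl[of _ "tensor_relations A rat_group" ?FA]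
        by (auto simp: z tensor_kernel_def rat_group_def distrib_right diff_diff_eq)
    next
      case (diff x y)
      have "?\<phi> (p + q) (x - y) - (?\<phi> p (x - y) + ?\<phi> q (x - y)) =
        (?\<phi> (p + q) x - (?\<phi> p x + ?\<phi> q x)) - (?\<phi> (p + q) y - (?\<phi> p y + ?\<phi> q y))"
        by (simp add: frag_extend_diff)
      with tensor_kernel_diff[OF A B diff.IH] show ?case by (simp only:)
    qed
  qed
  have comp: "?\<phi> p (?\<phi> q x) = ?\<phi> (p * q) x" for p q x
    using frag_extend_compose[of "\<lambda>(a, r). frag_of (a, p * r)" "\<lambda>(a, r). (a, q * r)" x]
    by (simp add: o_def case_prod_unfold mult.assoc)
  have one: "?\<phi> 1 x = x" for x
    using frag_expansion[of x] by (simp add: case_prod_unfold)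
  have rec: "carrier (rationalization A) = carrier (tensor_product A rat_group)"
    "add (rationalization A) = (\<otimes>\<^bsub>tensor_product A rat_group\<^esub>)"
    "\<zero>\<^bsub>rationalization A\<^esub> = \<one>\<^bsub>tensor_product A rat_group\<^esub>"
    by (simp_all add: rationalization_def)
  have ab: "abelian_group (rationalization A)"
    by (rule abelian_groupI; unfold rec)
       (blast intro: T.m_closed | rule T.one_closed | erule (2) T.m_assoc | erule (1) T.m_comm |
        erule T.l_one | metis T.l_inv T.inv_closed)+
  have "field (class_ring :: rat ring)"
    by (rule class_field.field_axioms)
  moreover have "module class_ring (rationalization A)"
  proof (rule moduleI)
    show "cring (class_ring :: rat ring)"
      by (rule class_cring.cring_axioms)
    show "abelian_group (rationalization A)" by (rule ab)
    show "q \<odot>\<^bsub>rationalization A\<^esub> x \<in> carrier (rationalization A)"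
      if "x \<in> carrier (rationalization A)" for q x
      using that unfolding carr by (auto simp only: UN_iff singleton_iff smult intro: keys)
    show "(p \<oplus>\<^bsub>class_ring\<^esub> q) \<odot>\<^bsub>rationalization A\<^esub> x =
        p \<odot>\<^bsub>rationalization A\<^esub> x \<oplus>\<^bsub>rationalization A\<^esub> q \<odot>\<^bsub>rationalization A\<^esub> x"
      if "x \<in> carrier (rationalization A)" for p q x
    proof -
      from that obtain c where c: "c \<in> carrier ?FA" "x = ?N #>\<^bsub>?FA\<^esub> c"
        unfolding carr by blast
      have "?N #>\<^bsub>?FA\<^esub> ?\<phi> (p + q) c = ?N #>\<^bsub>?FA\<^esub> (?\<phi> p c + ?\<phi> q c)"
        by (intro tensor_coset_eqI[OF A B] distr c)
      then show ?thesis
        by (simp only: c(2) smult add[OF keys[OF c(1)] keys[OF c(1)]] ring_record_simps)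
    qed
    show "q \<odot>\<^bsub>rationalization A\<^esub> (x \<oplus>\<^bsub>rationalization A\<^esub> y) =
        q \<odot>\<^bsub>rationalization A\<^esub> x \<oplus>\<^bsub>rationalization A\<^esub> q \<odot>\<^bsub>rationalization A\<^esub> y"
      if "x \<in> carrier (rationalization A)" "y \<in> carrier (rationalization A)" for q x y
    proof -
      from that obtain c d where "c \<in> carrier ?FA" "x = ?N #>\<^bsub>?FA\<^esub> c"
          "d \<in> carrier ?FA" "y = ?N #>\<^bsub>?FA\<^esub> d"
        unfolding carr by blast
      then show ?thesis
        by (simp only: smult add keys frag_extend_add)
    qed
    show "(p \<otimes>\<^bsub>class_ring\<^esub> q) \<odot>\<^bsub>rationalization A\<^esub> x =
        p \<odot>\<^bsub>rationalization A\<^esub> (q \<odot>\<^bsub>rationalization A\<^esub> x)"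
      if "x \<in> carrier (rationalization A)" for p q x
    proof -
      from that obtain c where c: "c \<in> carrier ?FA" "x = ?N #>\<^bsub>?FA\<^esub> c"
        unfolding carr by blast
      then show ?thesis by (simp only: c smult comp monoid_record_simps)
    qed
    show "\<one>\<^bsub>class_ring\<^esub> \<odot>\<^bsub>rationalization A\<^esub> x = x" if "x \<in> carrier (rationalization A)" for x
    proof -
      from that obtain c where c: "c \<in> carrier ?FA" "x = ?N #>\<^bsub>?FA\<^esub> c"
        unfolding carr by blast
      then show ?thesis by (simp only: c smult one monoid_record_simps)
    qed
  qed
  ultimately show ?thesis
    by (simp add: vectorspace_def)
qed

lemma smult_rationalization:
  assumes "comm_group A"
  shows "q \<odot>\<^bsub>rationalization A\<^esub> tensor_pure A rat_group a r = tensor_pure A rat_group a (q * r)"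
proof -
  have "(\<lambda>a. a) \<in> hom A A" "(\<lambda>r. q * r) \<in> hom rat_group rat_group"
    by (auto simp: hom_def rat_group_def distrib_left)
  then show ?thesis
    using tensor_map_pure[OF assms comm_group_rat_group] by (simp add: rationalization_def)
qed

definition alexander_invariant :: "('a, 'b) monoid_scheme \<Rightarrow> 'a set monoid" where
  "alexander_invariant G =
     G\<lparr>carrier := derived G (carrier G)\<rparr> Mod derived G (derived G (carrier G))"

text \<open>The action of the class \<open>C\<close> of \<open>h\<close> on the class \<open>D\<close> of \<open>g\<close> is the class of
  \<open>h g h\<inverse>\<close>; all members of the union below are equal.\<close>

definition alexander_action :: "('a, 'b) monoid_scheme \<Rightarrow> 'a set \<Rightarrow> 'a set \<Rightarrow> 'a set" where
  "alexander_action G C D =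
     (\<Union>h \<in> C. \<Union>g \<in> D. derived G (derived G (carrier G)) #>\<^bsub>G\<^esub> (h \<otimes>\<^bsub>G\<^esub> g \<otimes>\<^bsub>G\<^esub> inv\<^bsub>G\<^esub> h))"

lemma (in group) second_derived_normal: "derived G (derived G (carrier G)) \<lhd> G"
  by (intro derived_is_normal derived_self_is_normal)

lemma (in group) comm_group_alexander_invariant: "comm_group (alexander_invariant G)"
proof -
  have sub: "subgroup (derived G (carrier G)) G"
    by (intro derived_is_subgroup subset_refl)
  have "derived G (derived G (carrier G)) =
      derived (G\<lparr>carrier := derived G (carrier G)\<rparr>) (carrier (G\<lparr>carrier := derived G (carrier G)\<rparr>))"
    using derived_consistent[OF subset_refl sub] by simp
  then show ?thesis
    using group.comm_group_abelianization[OF subgroup_imp_group[OF sub]]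
    by (simp add: alexander_invariant_def abelianization_def)
qed

lemma (in group) alexander_action_coset:
  assumes h: "h \<in> carrier G" and g: "g \<in> derived G (carrier G)"
  shows "alexander_action G (derived G (carrier G) #> h) (derived G (derived G (carrier G)) #> g) =
    derived G (derived G (carrier G)) #> (h \<otimes> g \<otimes> inv h)"
proof -
  let ?D1 = "derived G (carrier G)" and ?D2 = "derived G (derived G (carrier G))"
  interpret D1: normal ?D1 G by (rule derived_self_is_normal)
  interpret D2: normal ?D2 G by (rule second_derived_normal)
  have D21: "?D2 \<subseteq> ?D1"
    by (intro derived_incl subset_refl D1.subgroup_axioms)
  let ?x = "h \<otimes> g \<otimes> inv h"
  have x: "?x \<in> ?D1" by (rule D1.inv_op_closed2[OF h g])
  have eq: "?D2 #> (h' \<otimes> g' \<otimes> inv h') = ?D2 #> ?x"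
    if "h' \<in> ?D1 #> h" "g' \<in> ?D2 #> g" for h' g'
  proof -
    from that obtain k m where k: "k \<in> ?D1" "h' = k \<otimes> h" and m: "m \<in> ?D2" "g' = m \<otimes> g"
      unfolding r_coset_def by auto
    define m' where "m' = h \<otimes> m \<otimes> inv h"
    have m': "m' \<in> ?D2" unfolding m'_def by (rule D2.inv_op_closed2[OF h m(1)])
    define y where "y = m' \<otimes> ?x"
    have y: "y \<in> ?D1" unfolding y_def using D1.m_closed[OF subsetD[OF D21 m'] x] .
    define c where "c = k \<otimes> y \<otimes> inv k \<otimes> inv y"
    have c: "c \<in> ?D2"
      unfolding c_def derived_def[of G ?D1] using k y by (intro generate.incl) auto
    have carr: "k \<in> carrier G" "m \<in> carrier G" "g \<in> carrier G" "m' \<in> carrier G" "y \<in> carrier G"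
      "c \<in> carrier G" "?x \<in> carrier G"
      using k(1) m(1) g m' y c x D1.subset D2.subset by blast+
    have *: "a \<otimes> (inv a \<otimes> b) = b" "inv a \<otimes> (a \<otimes> b) = b" if "a \<in> carrier G" "b \<in> carrier G" for a b
      using that by (simp_all add: m_assoc[symmetric])
    have "y = h \<otimes> m \<otimes> g \<otimes> inv h"
      unfolding y_def m'_def using carr(1-3) h by (simp add: m_assoc *)
    then have "h' \<otimes> g' \<otimes> inv h' = k \<otimes> y \<otimes> inv k"
      using carr(1-3) h by (simp add: k m m_assoc inv_mult_group)
    also have "\<dots> = (c \<otimes> m') \<otimes> ?x"
      unfolding c_def using carr(1,4,5,7) by (simp add: y_def m_assoc inv_mult_group *)
    finally have "h' \<otimes> g' \<otimes> inv h' \<in> ?D2 #> ?x"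
      unfolding r_coset_def using D2.m_closed[OF c m'] by auto
    then show ?thesis
      using repr_independence[OF _ carr(7) D2.subgroup_axioms] by metis
  qed
  have "h \<in> ?D1 #> h" "g \<in> ?D2 #> g"
    using rcos_self h g D1.subgroup_axioms D2.subgroup_axioms D1.subset by blast+
  with eq show ?thesis
    unfolding alexander_action_def by blast
qed

definition alexander_action_rat :: "('a, 'b) monoid_scheme \<Rightarrow> 'a set \<Rightarrow>
    ('a set \<times> rat \<Rightarrow>\<^sub>0 int) set \<Rightarrow> ('a set \<times> rat \<Rightarrow>\<^sub>0 int) set" where
  "alexander_action_rat G C =
     tensor_map (alexander_invariant G) rat_group (alexander_action G C) (\<lambda>r. r)"

definition trivial_alexander_action_rat :: "('a, 'b) monoid_scheme \<Rightarrow> bool" where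
  "trivial_alexander_action_rat G \<longleftrightarrow>
     (\<forall>C \<in> carrier (abelianization G). \<forall>x \<in> carrier (rationalization (alexander_invariant G)).
        alexander_action_rat G C x = x)"

lemma (in group) alexander_action_hom:
  assumes h: "h \<in> carrier G"
  shows "alexander_action G (derived G (carrier G) #> h)
    \<in> hom (alexander_invariant G) (alexander_invariant G)"
proof -
  let ?D1 = "derived G (carrier G)" and ?D2 = "derived G (derived G (carrier G))"
  let ?f = "alexander_action G (?D1 #> h)"
  interpret D1: normal ?D1 G by (rule derived_self_is_normal)
  interpret D2: normal ?D2 G by (rule second_derived_normal)
  have carr: "carrier (alexander_invariant G) = (\<lambda>g. ?D2 #> g) ` ?D1"
    by (auto simp: alexander_invariant_def FactGroup_def RCOSETS_def r_coset_def)
  have mult: "X \<otimes>\<^bsub>alexander_invariant G\<^esub> Y = X <#> Y" for X Y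
    by (simp add: alexander_invariant_def FactGroup_def set_mult_def)
  show ?thesis
  proof (rule homI)
    fix X assume "X \<in> carrier (alexander_invariant G)"
    then obtain g where g: "g \<in> ?D1" "X = ?D2 #> g" unfolding carr by blast
    have "?f X = ?D2 #> (h \<otimes> g \<otimes> inv h)"
      unfolding g(2) by (rule alexander_action_coset[OF h g(1)])
    with D1.inv_op_closed2[OF h g(1)] show "?f X \<in> carrier (alexander_invariant G)"
      unfolding carr by blast
  next
    fix X Y assume "X \<in> carrier (alexander_invariant G)" "Y \<in> carrier (alexander_invariant G)"
    then obtain g k where g: "g \<in> ?D1" "X = ?D2 #> g" and k: "k \<in> ?D1" "Y = ?D2 #> k"
      unfolding carr by blast
    have c: "g \<in> carrier G" "k \<in> carrier G" using g(1) k(1) D1.subset by blast+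
    have "inv h \<otimes> (h \<otimes> (k \<otimes> inv h)) = k \<otimes> inv h"
      using h c by (simp add: m_assoc[symmetric])
    then have e: "h \<otimes> (g \<otimes> k) \<otimes> inv h = (h \<otimes> g \<otimes> inv h) \<otimes> (h \<otimes> k \<otimes> inv h)"
      using h c by (simp add: m_assoc)
    have "?f (X <#> Y) = ?f (?D2 #> (g \<otimes> k))"
      unfolding g(2) k(2) D2.rcos_sum[OF c] ..
    also have "\<dots> = ?D2 #> (h \<otimes> (g \<otimes> k) \<otimes> inv h)"
      by (rule alexander_action_coset[OF h D1.m_closed[OF g(1) k(1)]])
    also have "\<dots> = (?D2 #> (h \<otimes> g \<otimes> inv h)) <#> (?D2 #> (h \<otimes> k \<otimes> inv h))"
      unfolding e by (rule D2.rcos_sum[symmetric]) (use h c in auto)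
    also have "\<dots> = ?f X <#> ?f Y"
      unfolding g(2) k(2) alexander_action_coset[OF h g(1)] alexander_action_coset[OF h k(1)] ..
    finally show "?f (X \<otimes>\<^bsub>alexander_invariant G\<^esub> Y) = ?f X \<otimes>\<^bsub>alexander_invariant G\<^esub> ?f Y"
      unfolding mult .
  qed
qed

lemma (in group) alexander_action_rat_pure:
  assumes "h \<in> carrier G" "g \<in> derived G (carrier G)"
  shows "alexander_action_rat G (derived G (carrier G) #> h)
      (tensor_pure (alexander_invariant G) rat_group (derived G (derived G (carrier G)) #> g) q) =
    tensor_pure (alexander_invariant G) rat_group
      (derived G (derived G (carrier G)) #> (h \<otimes> g \<otimes> inv h)) q"
proof -
  have "(\<lambda>r. r) \<in> hom rat_group rat_group"
    by (auto simp: hom_def)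
  then show ?thesis
    unfolding alexander_action_rat_def
    by (simp add: tensor_map_pure[OF comm_group_alexander_invariant comm_group_rat_group
          alexander_action_hom[OF assms(1)]] alexander_action_coset[OF assms])
qed

lemma vectorspace_gr_lcs:
  "vectorspace class_ring (rationalization (gr_lcs (IA n)))"
  "vectorspace class_ring (rationalization (gr_lcs (OA n)))"
  by (intro vectorspace_rationalization group.comm_group_gr_lcs group_IA group_OA)+

end

(* Specialize the Fox derivatives of F_n along F_n -> Z = <1 + X>, sending the generator 0 to 1 + X
   and the others to 1. The Jacobians then represent IA_n by matrices over the power series in X
   that are congruent to 1 modulo X, so the lower central series maps into the congruence
   filtration modulo powers of X. Inner automorphisms scale the Fox derivatives of words
   specializing to 1, hence the ratio f of the entries (1,2) and (2,2) also makes sense on OA_n; on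
   the s-th term it is divisible by X^s and additive modulo X^(2s). Let u multiply the generator 2
   by the commutator of 0 and 1, and let d conjugate the generator 1 by 0. Then f takes the value
   (-1)^(s-1) X^s on the iterated commutator [u, d, ..., d] of weight s. So the coefficient of X^s
   is a nonzero functional on the s-th graded piece, for every s; and the coefficient of X^3,
   which is additive on the derived subgroup, is not invariant under conjugation by d. *)

theory Submission
  imports Defs "HOL-Computational_Algebra.Formal_Power_Series"
begin

section \<open>Linear functionals on a rationalization\<close>

text \<open>The linear extension of (a, r) |-> c a * r to formal sums of pairs. For a homomorphism
  \<open>c\<close> it induces the tensor product of \<open>c\<close> with the identity of Q.\<close>

definition rational_pairing :: "('a \<Rightarrow> rat) \<Rightarrow> ('a \<times> rat \<Rightarrow>\<^sub>0 int) \<Rightarrow> rat" where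
  "rational_pairing c x =
     (\<Sum>k \<in> Poly_Mapping.keys x. of_int (Poly_Mapping.lookup x k) * (c (fst k) * snd k))"

lemma rational_pairing_superset:
  assumes "finite S" "Poly_Mapping.keys x \<subseteq> S"
  shows "rational_pairing c x =
    (\<Sum>k \<in> S. of_int (Poly_Mapping.lookup x k) * (c (fst k) * snd k))"
  unfolding rational_pairing_def
  by (rule sum.mono_neutral_left) (use assms in \<open>auto simp: in_keys_iff\<close>)

lemma rational_pairing_diff:
  "rational_pairing c (x - y) = rational_pairing c x - rational_pairing c y"
proof -
  let ?S = "Poly_Mapping.keys x \<union> Poly_Mapping.keys y"
  have S: "finite ?S" by simp
  show ?thesis
    using keys_diff[of x y]
    by (simp add: rational_pairing_superset[OF S] lookup_minus left_diff_distrib sum_subtractf)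
qed

lemma rational_pairing_0 [simp]: "rational_pairing c 0 = 0"
  by (simp add: rational_pairing_def)

lemma rational_pairing_add:
  "rational_pairing c (x + y) = rational_pairing c x + rational_pairing c y"
  using rational_pairing_diff[of c x "0 - y"] rational_pairing_diff[of c 0 y] by simp

lemma rational_pairing_of [simp]: "rational_pairing c (frag_of (a, r)) = c a * r"
  by (simp add: rational_pairing_def)

text \<open>Rational scalars act on the second tensor factor, so this makes the induced functional
  Q-linear.\<close>

lemma rational_pairing_scale:
  "rational_pairing c (frag_extend (\<lambda>(a, r). frag_of (a, q * r)) x) = q * rational_pairing c x"
proof -
  have "Poly_Mapping.keys x \<subseteq> UNIV" by simp
  then show ?thesis
  proof (induction x rule: frag_induction)
    case (one z)
    then show ?case by (cases z) simp
  qed (simp_all add: frag_extend_diff rational_pairing_diff right_diff_distrib)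
qed

text \<open>The kernel is generated by the relations of additivity in each argument. The first kind
  is respected because \<open>c\<close> is additive, the second by distributivity.\<close>

lemma rational_pairing_tensor_kernel:
  assumes A: "comm_group A" and c: "c \<in> hom A rat_group" and x: "x \<in> tensor_kernel A rat_group"
  shows "rational_pairing c x = 0"
proof -
  have rel: "rational_pairing c h = 0" if "h \<in> tensor_relations A rat_group" for h
    using that c
    by (auto simp: tensor_relations_def rational_pairing_diff hom_def rat_group_def
        distrib_left distrib_right)
  show ?thesis
    using x unfolding tensor_kernel_def
  proof (induction rule: generate.induct)
    case (inv h)
    then have "inv\<^bsub>free_Abelian_group (carrier A \<times> carrier rat_group)\<^esub> h = 0 - h"
      using tensor_relations_in_carrier[OF A comm_group_rat_group] by (auto simp: subset_iff)
    then show ?case using rel[OF inv] by (simp add: rational_pairing_diff del: diff_0)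
  qed (use rel in \<open>auto simp: rational_pairing_add\<close>)
qed

text \<open>An arbitrary representative stands in for a map on the quotient; its choice does not
  matter when \<open>c\<close> is a homomorphism.\<close>

definition rational_functional ::
  "('a \<Rightarrow> rat) \<Rightarrow> ('a \<times> rat \<Rightarrow>\<^sub>0 int) set \<Rightarrow> rat" where
  "rational_functional c C = rational_pairing c (SOME x. x \<in> C)"

lemma rational_functional_coset:
  assumes A: "comm_group A" and c: "c \<in> hom A rat_group"
  shows "rational_functional c
    (tensor_kernel A rat_group #>\<^bsub>free_Abelian_group (carrier A \<times> carrier rat_group)\<^esub> x) =
      rational_pairing c x" (is "rational_functional c ?C = _")
proof -
  have "0 + x \<in> ?C"
    unfolding r_coset_def using tensor_kernel_0 by auto
  then have "(SOME y. y \<in> ?C) \<in> ?C"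
    by (rule someI)
  then obtain k where "k \<in> tensor_kernel A rat_group" "(SOME y. y \<in> ?C) = k + x"
    unfolding r_coset_def by auto
  then show ?thesis
    using rational_pairing_tensor_kernel[OF A c]
    by (simp add: rational_functional_def rational_pairing_add)
qed

lemma rational_functional_pure:
  assumes "comm_group A" "c \<in> hom A rat_group"
  shows "rational_functional c (tensor_pure A rat_group a r) = c a * r"
  unfolding tensor_pure_def by (simp add: rational_functional_coset[OF assms])

lemma carrier_rationalizationE:
  assumes "C \<in> carrier (rationalization A)"
  obtains x where "Poly_Mapping.keys x \<subseteq> carrier A \<times> UNIV"
    "C = tensor_kernel A rat_group #>\<^bsub>free_Abelian_group (carrier A \<times> carrier rat_group)\<^esub> x"
  using assms
  by (auto simp: rationalization_def tensor_product_def FactGroup_def RCOSETS_def rat_group_def)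

lemma tensor_pure_in_rationalization:
  "a \<in> carrier A \<Longrightarrow> tensor_pure A rat_group a r \<in> carrier (rationalization A)"
  unfolding rationalization_def tensor_product_def FactGroup_def RCOSETS_def tensor_pure_def
  by (auto simp: rat_group_def intro!: exI[of _ "frag_of (a, r)"])

lemma submodule_rational_functional_kernel:
  assumes A: "comm_group A" and c: "c \<in> hom A rat_group"
  shows "submodule class_ring {C \<in> carrier (rationalization A). rational_functional c C = 0}
    (rationalization A)"
proof -
  let ?FA = "free_Abelian_group (carrier A \<times> carrier rat_group)"
  let ?N = "tensor_kernel A rat_group"
  interpret V: vectorspace "class_ring :: rat ring" "rationalization A"
    by (rule vectorspace_rationalization[OF A])
  interpret N: normal ?N ?FA
    by (rule tensor_kernel_normal[OF A comm_group_rat_group])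
  have add: "rational_functional c (C \<oplus>\<^bsub>rationalization A\<^esub> D) =
      rational_functional c C + rational_functional c D"
    if C: "C \<in> carrier (rationalization A)" and D: "D \<in> carrier (rationalization A)" for C D
  proof -
    obtain x where x: "Poly_Mapping.keys x \<subseteq> carrier A \<times> UNIV" "C = ?N #>\<^bsub>?FA\<^esub> x"
      using C by (rule carrier_rationalizationE)
    obtain y where y: "Poly_Mapping.keys y \<subseteq> carrier A \<times> UNIV" "D = ?N #>\<^bsub>?FA\<^esub> y"
      using D by (rule carrier_rationalizationE)
    have "x \<in> carrier ?FA" "y \<in> carrier ?FA"
      using x(1) y(1) by (simp_all add: rat_group_def)
    from N.rcos_sum[OF this] have "C \<oplus>\<^bsub>rationalization A\<^esub> D = ?N #>\<^bsub>?FA\<^esub> (x + y)"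
      by (simp add: x y rationalization_def tensor_product_def FactGroup_def)
    then show ?thesis
      by (simp add: x y rational_functional_coset[OF A c] rational_pairing_add)
  qed
  have smult: "rational_functional c (q \<odot>\<^bsub>rationalization A\<^esub> C) = q * rational_functional c C"
    if C: "C \<in> carrier (rationalization A)" for q C
  proof -
    obtain x where x: "C = ?N #>\<^bsub>?FA\<^esub> x"
      using C by (rule carrier_rationalizationE)
    have "(\<lambda>a. a) \<in> hom A A" "(\<lambda>r. q * r) \<in> hom rat_group rat_group"
      by (auto simp: hom_def rat_group_def distrib_left)
    then show ?thesis
      by (simp add: x rationalization_def tensor_map_coset[OF A comm_group_rat_group]
          rational_functional_coset[OF A c] rational_pairing_scale)
  qed
  have zero: "rational_functional c \<zero>\<^bsub>rationalization A\<^esub> = 0"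
    using add[OF V.M.zero_closed V.M.zero_closed] by simp
  show ?thesis
    by (rule submodule.intro[OF V.module_axioms]) (auto simp: add smult zero)
qed

text \<open>A tensor is a finite sum of pure tensors, so only finitely many of the functionals are
  nonzero on it, and likewise on a finite spanning set. Some functional of the infinite family then
  vanishes on the whole span, yet each is nonzero on some pure tensor.\<close>

lemma not_fin_dim_rationalization:
  assumes A: "comm_group A"
    and c: "\<And>s. s \<in> S \<Longrightarrow> c s \<in> hom A rat_group"
    and S: "infinite S"
    and vanish: "\<And>a. a \<in> carrier A \<Longrightarrow> finite {s \<in> S. c s a \<noteq> 0}"
    and nonzero: "\<And>s. s \<in> S \<Longrightarrow> \<exists>a \<in> carrier A. c s a \<noteq> 0"
  shows "\<not> vectorspace.fin_dim class_ring (rationalization A)"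
proof
  interpret V: vectorspace "class_ring :: rat ring" "rationalization A"
    by (rule vectorspace_rationalization[OF A])
  assume "vectorspace.fin_dim class_ring (rationalization A)"
  then obtain B where B: "finite B" "B \<subseteq> carrier (rationalization A)"
      "V.span B = carrier (rationalization A)"
    unfolding V.fin_dim_def by blast
  have fin: "finite {s \<in> S. rational_functional (c s) C \<noteq> 0}"
    if C: "C \<in> carrier (rationalization A)" for C
  proof -
    obtain x where x: "Poly_Mapping.keys x \<subseteq> carrier A \<times> UNIV"
      "C = tensor_kernel A rat_group #>\<^bsub>free_Abelian_group (carrier A \<times> carrier rat_group)\<^esub> x"
      using C by (rule carrier_rationalizationE)
    have "{s \<in> S. rational_functional (c s) C \<noteq> 0}
        \<subseteq> (\<Union>k \<in> Poly_Mapping.keys x. {s \<in> S. c s (fst k) \<noteq> 0})"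
    proof
      fix s assume s: "s \<in> {s \<in> S. rational_functional (c s) C \<noteq> 0}"
      then have "rational_pairing (c s) x \<noteq> 0"
        using x(2) rational_functional_coset[OF A c] by auto
      then have "\<exists>k \<in> Poly_Mapping.keys x. c s (fst k) \<noteq> 0"
        unfolding rational_pairing_def by (metis (lifting) mult_zero_left mult_zero_right sum.neutral)
      with s show "s \<in> (\<Union>k \<in> Poly_Mapping.keys x. {s \<in> S. c s (fst k) \<noteq> 0})"
        by blast
    qed
    moreover have "finite \<dots>"
      using x(1) by (intro finite_UN_I finite_keys vanish) auto
    ultimately show ?thesis by (rule finite_subset)
  qed
  define U where "U = (\<Union>C \<in> B. {s \<in> S. rational_functional (c s) C \<noteq> 0})"
  have "finite U"
    unfolding U_def using B fin by blast
  then have "infinite (S - U)"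
    using S by (rule Diff_infinite_finite)
  then have "S - U \<noteq> {}"
    by (metis finite.emptyI)
  then obtain s where "s \<in> S" "s \<notin> U"
    by blast
  then have s: "s \<in> S" "\<And>C. C \<in> B \<Longrightarrow> rational_functional (c s) C = 0"
    by (auto simp: U_def)
  obtain a where a: "a \<in> carrier A" "c s a \<noteq> 0"
    using nonzero[OF s(1)] by blast
  have "V.span B \<subseteq> {C \<in> carrier (rationalization A). rational_functional (c s) C = 0}"
    using B(2) s(2)
    by (intro V.span_is_subset submodule_rational_functional_kernel[OF A c[OF s(1)]]) auto
  then have "rational_functional (c s) (tensor_pure A rat_group a 1) = 0"
    using tensor_pure_in_rationalization[OF a(1)] B(3) by auto
  then show False
    using a(2) by (simp add: rational_functional_pure[OF A c[OF s(1)]])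
qed

section \<open>Expansions along the lower central series\<close>

lemma fps_X_power_dvd_nth_eq_0:
  fixes a :: "'a :: comm_ring_1 fps"
  assumes "fps_X ^ k dvd a" "i < k"
  shows "fps_nth a i = 0"
  using assms by (auto simp: fps_X_power_mult_nth elim!: dvdE)

lemma (in group) hom_comm_group_derived:
  assumes "comm_group H" "h \<in> hom G H" "x \<in> derived G (carrier G)"
  shows "h x = \<one>\<^bsub>H\<^esub>"
proof -
  interpret H: comm_group H by fact
  interpret group_hom G H h
    using assms(2) by unfold_locales
  have "derived H (h ` carrier G) = {\<one>\<^bsub>H\<^esub>}"
    by (intro H.derived_eq_singleton) auto
  then show ?thesis
    using assms(3) derived_img[OF subset_refl] by blast
qed

section \<open>Commutators and terms of the lower central series\<close>

definition commutator :: "('a, 'b) monoid_scheme \<Rightarrow> 'a \<Rightarrow> 'a \<Rightarrow> 'a" where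
  "commutator G x y = x \<otimes>\<^bsub>G\<^esub> y \<otimes>\<^bsub>G\<^esub> inv\<^bsub>G\<^esub> x \<otimes>\<^bsub>G\<^esub> inv\<^bsub>G\<^esub> y"

lemma (in group) commutator_closed:
  "x \<in> carrier G \<Longrightarrow> y \<in> carrier G \<Longrightarrow> commutator G x y \<in> carrier G"
  by (simp add: commutator_def)

definition iterated_commutator :: "('a, 'b) monoid_scheme \<Rightarrow> 'a \<Rightarrow> 'a \<Rightarrow> nat \<Rightarrow> 'a" where
  "iterated_commutator G u d s = ((\<lambda>x. commutator G x d) ^^ s) u"

lemma iterated_commutator_simps [simp]:
  "iterated_commutator G u d 0 = u"
  "iterated_commutator G u d (Suc s) = commutator G (iterated_commutator G u d s) d"
  by (simp_all add: iterated_commutator_def)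

lemma (in group) lower_central_carrier: "lower_central G s \<subseteq> carrier G"
proof (cases s)
  case (Suc s')
  then show ?thesis
    using normal_imp_subgroup[OF lower_central_normal[of s']] subgroup.subset by blast
qed simp

lemma (in group) commutator_in_lower_central:
  assumes "x \<in> lower_central G (Suc s)" "y \<in> carrier G"
  shows "commutator G x y \<in> lower_central G (Suc (Suc s))"
  unfolding commutator_def lower_central.simps(3) using assms by (intro generate.incl) blast

lemma (in group) iterated_commutator_in_lower_central:
  assumes "u \<in> carrier G" "d \<in> carrier G"
  shows "iterated_commutator G u d s \<in> lower_central G (Suc s)"
  by (induction s) (use assms in \<open>auto simp del: lower_central.simps(3)
      intro: commutator_in_lower_central\<close>)

lemma (in group) lower_central_2: "lower_central G (Suc (Suc 0)) = derived G (carrier G)"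
  by (simp add: derived_def)

text \<open>A surjection maps the commutators generating one term onto those generating the
  corresponding term of the image. This carries the filtration from IA_n to OA_n.\<close>

lemma (in group_hom) lower_central_img:
  assumes "h ` carrier G = carrier H"
  shows "lower_central H s = h ` lower_central G s"
proof -
  have "lower_central H (Suc s) = h ` lower_central G (Suc s)" for s
  proof (induction s)
    case (Suc s)
    let ?L = "lower_central G (Suc s)"
    have L: "?L \<subseteq> carrier G" by (rule G.lower_central_carrier)
    have e: "h (x \<otimes> y \<otimes> inv x \<otimes> inv y) = h x \<otimes>\<^bsub>H\<^esub> h y \<otimes>\<^bsub>H\<^esub> inv\<^bsub>H\<^esub> h x \<otimes>\<^bsub>H\<^esub> inv\<^bsub>H\<^esub> h y"
      if "x \<in> ?L" "y \<in> carrier G" for x y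
      using that L by (simp add: subset_iff)
    have "(\<Union>x \<in> lower_central H (Suc s). \<Union>y \<in> carrier H.
          {x \<otimes>\<^bsub>H\<^esub> y \<otimes>\<^bsub>H\<^esub> inv\<^bsub>H\<^esub> x \<otimes>\<^bsub>H\<^esub> inv\<^bsub>H\<^esub> y}) =
        (\<Union>x \<in> ?L. \<Union>y \<in> carrier G. {h x \<otimes>\<^bsub>H\<^esub> h y \<otimes>\<^bsub>H\<^esub> inv\<^bsub>H\<^esub> h x \<otimes>\<^bsub>H\<^esub> inv\<^bsub>H\<^esub> h y})"
      unfolding Suc assms[symmetric] by blast
    also have "\<dots> = (\<Union>x \<in> ?L. \<Union>y \<in> carrier G. {h (x \<otimes> y \<otimes> inv x \<otimes> inv y)})"
      using e by (intro SUP_cong refl) auto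
    also have "\<dots> = h ` (\<Union>x \<in> ?L. \<Union>y \<in> carrier G. {x \<otimes> y \<otimes> inv x \<otimes> inv y})"
      by (simp add: image_UN)
    finally show ?case
      using L by (auto simp only: lower_central.simps intro!: generate_img G.m_closed G.inv_closed)
  qed (use assms in auto)
  then show ?thesis
    by (cases s) (use assms in auto)
qed

text \<open>The identity of the factor in degree s is the coset
  \<open>lower_central G (Suc s)\<close> itself, against which finite support is measured.\<close>

lemma (in group) carrier_gr_lcs:
  "carrier (gr_lcs G) = {a \<in> \<Pi>\<^sub>E s\<in>{1..}. (\<lambda>x. lower_central G (Suc s) #> x) ` lower_central G s.
     finite {s \<in> {1..}. a s \<noteq> lower_central G (Suc s)}}"
proof -
  let ?Q = "\<lambda>s. G\<lparr>carrier := lower_central G s\<rparr> Mod lower_central G (Suc s)"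
  have "group (?Q s)" if "s \<in> {1..}" for s
    using comm_group.axioms(2)[OF comm_group_lower_central_factor[of "s - 1"]] that
    by (cases s) auto
  moreover have "carrier (?Q s) = (\<lambda>x. lower_central G (Suc s) #> x) ` lower_central G s" for s
    by (auto simp: FactGroup_def RCOSETS_def r_coset_def)
  ultimately show ?thesis
    unfolding gr_lcs_def by (subst carrier_sum_group) auto
qed

text \<open>This isolates what is to be proved for IA_n and then transferred to OA_n: in each
  weight, \<open>f\<close> has at least that order and is additive up to twice that order. The
  iterated commutator with s copies of \<open>d\<close> has weight s + 1, whence the shift in the
  last assumption.\<close>

locale central_expansion = group G for G (structure) +
  fixes f :: "'a \<Rightarrow> rat fps" and u d :: 'a
  assumes expansion_dvd: "x \<in> lower_central G (Suc s) \<Longrightarrow> fps_X ^ Suc s dvd f x"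
    and expansion_mult: "x \<in> lower_central G (Suc s) \<Longrightarrow> y \<in> lower_central G (Suc s) \<Longrightarrow>
      fps_X ^ (2 * Suc s) dvd f (x \<otimes> y) - (f x + f y)"
    and u: "u \<in> carrier G" and d: "d \<in> carrier G"
    and expansion_nonzero: "fps_nth (f (iterated_commutator G u d s)) (Suc s) \<noteq> 0"
begin

lemma expansion_mult_nth:
  assumes "x \<in> lower_central G (Suc s)" "y \<in> lower_central G (Suc s)" "i < 2 * Suc s"
  shows "fps_nth (f (x \<otimes> y)) i = fps_nth (f x) i + fps_nth (f y) i"
  using fps_X_power_dvd_nth_eq_0[OF expansion_mult[OF assms(1,2)] assms(3)] by simp

text \<open>Weights start at 1, so index s refers to the component in degree s + 1. By
  \<open>lead_coset\<close> the choice of representative is harmless.\<close>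

definition lead :: "nat \<Rightarrow> (nat \<Rightarrow> 'a set) \<Rightarrow> rat" where
  "lead s a = fps_nth (f (SOME x. x \<in> a (Suc s))) (Suc s)"

text \<open>Another representative is a product m x with m one weight deeper. Additivity covers the
  coefficient s + 1 < 2 (s + 1), and m contributes 0 there because its expansion is divisible by
  X^(s+2).\<close>

lemma lead_coset:
  assumes x: "x \<in> lower_central G (Suc s)" and a: "a (Suc s) = lower_central G (Suc (Suc s)) #> x"
  shows "lead s a = fps_nth (f x) (Suc s)"
proof -
  let ?M = "lower_central G (Suc (Suc s))"
  have "x \<in> a (Suc s)"
    unfolding a using x lower_central_carrier
    by (intro rcos_self normal_imp_subgroup lower_central_normal) auto
  then have "(SOME x. x \<in> a (Suc s)) \<in> ?M #> x"
    unfolding a[symmetric] by (rule someI)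
  then obtain m where m: "m \<in> ?M" "(SOME x. x \<in> a (Suc s)) = m \<otimes> x"
    unfolding r_coset_def by auto
  have "fps_nth (f (m \<otimes> x)) (Suc s) = fps_nth (f m) (Suc s) + fps_nth (f x) (Suc s)"
    using m(1) lower_central_decreasing x by (intro expansion_mult_nth) auto
  moreover have "fps_nth (f m) (Suc s) = 0"
    using fps_X_power_dvd_nth_eq_0[OF expansion_dvd[OF m(1)]] by simp
  ultimately show ?thesis
    by (simp add: lead_def m(2))
qed

lemma lead_hom: "lead s \<in> hom (gr_lcs G) rat_group"
proof (rule homI)
  fix a b assume a: "a \<in> carrier (gr_lcs G)" and b: "b \<in> carrier (gr_lcs G)"
  let ?L = "lower_central G (Suc s)" and ?M = "lower_central G (Suc (Suc s))"
  have "Suc s \<in> {1..}" by simp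
  then have "a (Suc s) \<in> (\<lambda>x. ?M #> x) ` ?L" "b (Suc s) \<in> (\<lambda>x. ?M #> x) ` ?L"
    using a b unfolding carrier_gr_lcs mem_Collect_eq by (blast dest: PiE_mem)+
  then obtain x y where x: "x \<in> ?L" "a (Suc s) = ?M #> x" and y: "y \<in> ?L" "b (Suc s) = ?M #> y"
    by blast
  interpret L: normal ?L G by (rule lower_central_normal)
  interpret M: normal ?M G by (rule lower_central_normal)
  have "(a \<otimes>\<^bsub>gr_lcs G\<^esub> b) (Suc s) = a (Suc s) <#> b (Suc s)"
    by (simp add: gr_lcs_def set_mult_def)
  also have "\<dots> = ?M #> (x \<otimes> y)"
    unfolding x y using x(1) y(1) L.subset by (intro M.rcos_sum) auto
  finally have "lead s (a \<otimes>\<^bsub>gr_lcs G\<^esub> b) = fps_nth (f (x \<otimes> y)) (Suc s)"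
    by (intro lead_coset L.m_closed x y)
  then show "lead s (a \<otimes>\<^bsub>gr_lcs G\<^esub> b) = lead s a \<otimes>\<^bsub>rat_group\<^esub> lead s b"
    using lead_coset[where a = a, OF x] lead_coset[where a = b, OF y] expansion_mult_nth[OF x(1) y(1)]
    by (simp add: rat_group_def)
qed (simp add: rat_group_def)

lemma lead_one:
  assumes "a (Suc s) = lower_central G (Suc (Suc s))"
  shows "lead s a = 0"
proof -
  interpret L: normal "lower_central G (Suc s)" G by (rule lower_central_normal)
  interpret M: normal "lower_central G (Suc (Suc s))" G by (rule lower_central_normal)
  have "lead s a = fps_nth (f \<one>) (Suc s)"
    by (intro lead_coset L.one_closed) (simp add: assms M.subset del: lower_central.simps)
  then show ?thesis
    using fps_X_power_dvd_nth_eq_0[OF expansion_dvd[OF M.one_closed]] by simp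
qed

theorem not_fin_dim_gr_lcs:
  "\<not> vectorspace.fin_dim class_ring (rationalization (gr_lcs G))"
proof (rule not_fin_dim_rationalization[OF comm_group_gr_lcs lead_hom])
  show "infinite (UNIV :: nat set)" by simp
next
  fix a assume a: "a \<in> carrier (gr_lcs G)"
  let ?F = "{s \<in> {1..}. a s \<noteq> lower_central G (Suc s)}"
  have "finite ?F" using a unfolding carrier_gr_lcs by blast
  \<comment> \<open>\<open>lead s\<close> sees degree s + 1, so the finite support is pulled back
    along \<open>Suc\<close>.\<close>
  then have "finite (Suc -` ?F)" by (intro finite_vimageI) auto
  then show "finite {s \<in> UNIV. lead s a \<noteq> 0}"
    by (rule rev_finite_subset) (use lead_one in auto)
next
  fix s
  let ?g = "iterated_commutator G u d s" and ?M = "\<lambda>s. lower_central G (Suc s)"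
  have g: "?g \<in> ?M s"
    by (intro iterated_commutator_in_lower_central u d)
  \<comment> \<open>The class of the iterated commutator, placed in degree s + 1 of the direct sum
    with identities elsewhere.\<close>
  define a where "a = (\<lambda>i\<in>{1..}. if i = Suc s then ?M i #> ?g else ?M i)"
  have M: "?M i \<in> (\<lambda>x. ?M i #> x) ` lower_central G i" if "i \<ge> 1" for i
  proof -
    obtain j where j: "i = Suc j" using \<open>i \<ge> 1\<close> by (cases i) auto
    have "\<one> \<in> lower_central G i"
      unfolding j by (intro subgroup.one_closed normal_imp_subgroup lower_central_normal)
    moreover have "?M i = ?M i #> \<one>"
      using lower_central_carrier by simp
    ultimately show ?thesis by blast
  qed
  have "a \<in> carrier (gr_lcs G)"
    unfolding carrier_gr_lcs mem_Collect_eq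
  proof
    show "a \<in> (\<Pi>\<^sub>E i\<in>{1..}. (\<lambda>x. ?M i #> x) ` lower_central G i)"
      using M g by (auto simp: a_def simp del: lower_central.simps)
    show "finite {i \<in> {1..}. a i \<noteq> ?M i}"
      by (rule finite_subset[of _ "{Suc s}"]) (auto simp: a_def)
  qed
  moreover have "lead s a = fps_nth (f ?g) (Suc s)"
    by (rule lead_coset[OF g]) (simp add: a_def)
  ultimately show "\<exists>a\<in>carrier (gr_lcs G). lead s a \<noteq> 0"
    using expansion_nonzero by metis
qed

text \<open>The derived subgroup is the second term of the lower central series, so that the third
  coefficient is still additive on it; unlike the leading one it is not invariant under
  conjugation.\<close>

definition third :: "'a set \<Rightarrow> rat" where
  "third a = fps_nth (f (SOME x. x \<in> a)) 3"

text \<open>In weight 2 additivity holds modulo X^4, which reaches one coefficient beyond the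
  leading one.\<close>

lemma derived_nth_mult:
  assumes "x \<in> derived G (carrier G)" "y \<in> derived G (carrier G)"
  shows "fps_nth (f (x \<otimes> y)) 3 = fps_nth (f x) 3 + fps_nth (f y) 3"
  using expansion_mult_nth[of x 1 y 3] assms lower_central_2 by simp

text \<open>On the derived subgroup this coefficient is a homomorphism to the abelian group Q, so it
  vanishes on the second derived subgroup.\<close>

lemma third_coset:
  assumes x: "x \<in> derived G (carrier G)"
  shows "third (derived G (derived G (carrier G)) #> x) = fps_nth (f x) 3"
proof -
  let ?D = "derived G (carrier G)"
  interpret D: normal ?D G by (rule derived_self_is_normal)
  interpret D2: normal "derived G ?D" G by (rule second_derived_normal)
  have "x \<in> derived G ?D #> x"
    using x D.subset by (intro rcos_self D2.subgroup_axioms) auto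
  then have "(SOME y. y \<in> derived G ?D #> x) \<in> derived G ?D #> x"
    by (rule someI)
  then obtain m where m: "m \<in> derived G ?D" "(SOME y. y \<in> derived G ?D #> x) = m \<otimes> x"
    unfolding r_coset_def by auto
  have mD: "m \<in> ?D"
    using m(1) derived_incl[OF subset_refl D.subgroup_axioms] by blast
  have "(\<lambda>x. fps_nth (f x) 3) \<in> hom (G\<lparr>carrier := ?D\<rparr>) rat_group"
    by (auto simp: hom_def rat_group_def derived_nth_mult)
  moreover have "m \<in> derived (G\<lparr>carrier := ?D\<rparr>) (carrier (G\<lparr>carrier := ?D\<rparr>))"
    using m(1) derived_consistent[OF subset_refl D.subgroup_axioms] by simp
  ultimately have "fps_nth (f m) 3 = \<one>\<^bsub>rat_group\<^esub>"
    by (rule group.hom_comm_group_derived[OF subgroup_imp_group[OF D.subgroup_axioms]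
          comm_group_rat_group])
  then show ?thesis
    by (simp add: third_def m(2) derived_nth_mult[OF mD x] rat_group_def)
qed

lemma third_hom: "third \<in> hom (alexander_invariant G) rat_group"
proof (rule homI)
  let ?D = "derived G (carrier G)"
  interpret D: normal ?D G by (rule derived_self_is_normal)
  interpret D2: normal "derived G ?D" G by (rule second_derived_normal)
  have carr: "carrier (alexander_invariant G) = (\<lambda>g. derived G ?D #> g) ` ?D"
    by (auto simp: alexander_invariant_def FactGroup_def RCOSETS_def r_coset_def)
  fix a b assume "a \<in> carrier (alexander_invariant G)" "b \<in> carrier (alexander_invariant G)"
  then obtain x y where x: "x \<in> ?D" "a = derived G ?D #> x" and y: "y \<in> ?D" "b = derived G ?D #> y"
    unfolding carr by blast
  have "a \<otimes>\<^bsub>alexander_invariant G\<^esub> b = a <#> b"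
    by (simp add: alexander_invariant_def FactGroup_def set_mult_def)
  also have "\<dots> = derived G ?D #> (x \<otimes> y)"
    unfolding x y using x(1) y(1) D.subset by (intro D2.rcos_sum) auto
  finally show "third (a \<otimes>\<^bsub>alexander_invariant G\<^esub> b) = third a \<otimes>\<^bsub>rat_group\<^esub> third b"
    using x y by (simp add: third_coset derived_nth_mult rat_group_def)
qed (simp add: rat_group_def)

text \<open>Put g = [u, d]. Then [g, d] is the product of g and d g^-1 d^-1, so its X^3 coefficient
  is that of g minus that of d g d^-1. A trivial action would make these equal, but [g, d] is the
  iterated commutator of weight 3, whose X^3 coefficient is nonzero.\<close>

theorem not_trivial_alexander_action_rat: "\<not> trivial_alexander_action_rat G"
proof
  assume triv: "trivial_alexander_action_rat G"
  let ?D = "derived G (carrier G)"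
  interpret D: normal ?D G by (rule derived_self_is_normal)
  define g where "g = iterated_commutator G u d 1"
  have g: "g \<in> ?D"
    using iterated_commutator_in_lower_central[OF u d, of 1]
    by (simp add: g_def lower_central_2 del: lower_central.simps iterated_commutator_simps)
  have gc: "g \<in> carrier G" using g D.subset by blast
  have h: "d \<otimes> inv g \<otimes> inv d \<in> ?D" "d \<otimes> g \<otimes> inv d \<in> ?D"
    using D.inv_op_closed2[OF d] g by auto
  let ?c = "\<lambda>x. derived G ?D #> x"
  let ?A = "alexander_invariant G"
  \<comment> \<open>This turns the inverse inside the conjugate into a minus sign on
    coefficients.\<close>
  have conj_inv: "(d \<otimes> g \<otimes> inv d) \<otimes> (d \<otimes> inv g \<otimes> inv d) = \<one>"
  proof -
    have "d \<otimes> inv g \<otimes> inv d = inv (d \<otimes> g \<otimes> inv d)"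
      using gc d by (simp add: m_assoc inv_mult_group)
    then show ?thesis using gc d by simp
  qed
  have cg: "?c g \<in> carrier ?A"
    using g by (auto simp: alexander_invariant_def FactGroup_def RCOSETS_def r_coset_def)
  have Dd: "?D #> d \<in> carrier (abelianization G)"
    using d by (auto simp: abelianization_def FactGroup_def RCOSETS_def)
  have "alexander_action_rat G (?D #> d) (tensor_pure ?A rat_group (?c g) 1) =
      tensor_pure ?A rat_group (?c g) 1"
    by (rule bspec[OF bspec[OF triv[unfolded trivial_alexander_action_rat_def] Dd]
          tensor_pure_in_rationalization[OF cg]])
  then have "tensor_pure ?A rat_group (?c (d \<otimes> g \<otimes> inv d)) 1 = tensor_pure ?A rat_group (?c g) 1"
    by (simp add: alexander_action_rat_pure[OF d g])
  then have "third (?c (d \<otimes> g \<otimes> inv d)) = third (?c g)"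
    using rational_functional_pure[OF comm_group_alexander_invariant third_hom, of _ 1]
    by (metis mult.right_neutral)
  then have eq: "fps_nth (f (d \<otimes> g \<otimes> inv d)) 3 = fps_nth (f g) 3"
    using g h by (simp add: third_coset)
  have "iterated_commutator G u d 2 = commutator G g d"
    by (simp add: numeral_2_eq_2 g_def)
  also have "\<dots> = g \<otimes> (d \<otimes> inv g \<otimes> inv d)"
    using gc d by (simp add: commutator_def m_assoc)
  finally have "fps_nth (f g) 3 + fps_nth (f (d \<otimes> inv g \<otimes> inv d)) 3 \<noteq> 0"
    using expansion_nonzero[of 2] derived_nth_mult[OF g h(1)] by (simp add: numeral_3_eq_3)
  moreover have "fps_nth (f (d \<otimes> g \<otimes> inv d)) 3 + fps_nth (f (d \<otimes> inv g \<otimes> inv d)) 3 = fps_nth (f \<one>) 3"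
    using derived_nth_mult[OF h(2,1)] conj_inv by simp
  moreover have "fps_nth (f \<one>) 3 = 0"
    using derived_nth_mult[OF D.one_closed D.one_closed] by simp
  ultimately show False
    using eq by simp
qed

text \<open>\<open>f\<close> is constant on the fibres of the surjection, and elements of lower
  central terms and iterated commutators lift to G, so each condition can be checked on
  preimages.\<close>

lemma central_expansion_image:
  assumes "group H" and h: "h \<in> hom G H" "h ` carrier G = carrier H"
    and f': "\<And>x. x \<in> carrier G \<Longrightarrow> f' (h x) = f x"
  shows "central_expansion H f' (h u) (h d)"
proof -
  interpret H: group H by fact
  interpret h: group_hom G H h using h(1) by unfold_locales
  note img = h.lower_central_img[OF h(2)]
  have L: "x \<in> carrier G" if "x \<in> lower_central G s" for x s
    using that lower_central_carrier by blast
  have it: "h (iterated_commutator G u d s) = iterated_commutator H (h u) (h d) s" for s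
  proof (induction s)
    case (Suc s)
    then show ?case
      using L[OF iterated_commutator_in_lower_central[OF u d, of s]] d
      by (simp add: commutator_def)
  qed simp
  show ?thesis
  proof
    fix x s assume "x \<in> lower_central H (Suc s)"
    then show "fps_X ^ Suc s dvd f' x"
      unfolding img using expansion_dvd L f' by fastforce
  next
    fix x y s assume "x \<in> lower_central H (Suc s)" "y \<in> lower_central H (Suc s)"
    then obtain x' y' where x: "x = h x'" "x' \<in> lower_central G (Suc s)"
      and y: "y = h y'" "y' \<in> lower_central G (Suc s)"
      unfolding img by blast
    have G: "x' \<in> carrier G" "y' \<in> carrier G"
      using x y L by blast+
    then have "x \<otimes>\<^bsub>H\<^esub> y = h (x' \<otimes> y')"
      using x y by simp
    with G show "fps_X ^ (2 * Suc s) dvd f' (x \<otimes>\<^bsub>H\<^esub> y) - (f' x + f' y)"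
      using expansion_mult[OF x(2) y(2)] f'[OF m_closed] by (simp add: x y f' del: h.hom_mult)
  next
    fix s
    show "fps_nth (f' (iterated_commutator H (h u) (h d) s)) (Suc s) \<noteq> 0"
      unfolding it[symmetric]
      using expansion_nonzero f' L[OF iterated_commutator_in_lower_central[OF u d]] by simp
  qed (use u d h in auto)
qed

end

section \<open>Homomorphisms out of free groups\<close>

lemma mult_free_group: "u \<otimes>\<^bsub>free_group S\<^esub> v = foldr push_letter u v"
  and one_free_group [simp]: "\<one>\<^bsub>free_group S\<^esub> = []"
  by (simp_all add: free_group_def)

lemma carrier_free_group: "w \<in> carrier (free_group S) \<longleftrightarrow> reduced w \<and> fst ` set w \<subseteq> S"
  by (simp add: free_group_def)

abbreviation gen :: "'a \<Rightarrow> 'a word" where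
  "gen x \<equiv> [(x, False)]"

lemma gen_in_free_group: "[(x, b)] \<in> carrier (free_group S) \<longleftrightarrow> x \<in> S"
  by (simp add: carrier_free_group)

lemma inv_gen: "x \<in> S \<Longrightarrow> inv\<^bsub>free_group S\<^esub> gen x = [(x, True)]"
  by (rule group.inv_equality[OF group_free_group])
    (auto simp: gen_in_free_group mult_free_group push_letter_def inv_letter_def)

text \<open>The head of a reduced word splits off without cancellation. Phrasing the step by group
  products lets homomorphism laws and Fox rules apply directly.\<close>

lemma free_group_induct [consumes 1, case_names one gen inv]:
  assumes "w \<in> carrier (free_group S)"
    and "P []"
    and gen: "\<And>x w. x \<in> S \<Longrightarrow> w \<in> carrier (free_group S) \<Longrightarrow> P w \<Longrightarrow>
      P (gen x \<otimes>\<^bsub>free_group S\<^esub> w)"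
    and inv: "\<And>x w. x \<in> S \<Longrightarrow> w \<in> carrier (free_group S) \<Longrightarrow> P w \<Longrightarrow>
      P (inv\<^bsub>free_group S\<^esub> gen x \<otimes>\<^bsub>free_group S\<^esub> w)"
  shows "P w"
  using assms(1)
proof (induction w)
  case (Cons a w)
  obtain x b where a: "a = (x, b)" by (cases a)
  have w: "w \<in> carrier (free_group S)" and x: "x \<in> S"
    using Cons.prems by (auto simp: carrier_free_group reduced_Cons a)
  have "a # w = [a] \<otimes>\<^bsub>free_group S\<^esub> w"
    using Cons.prems push_reduced[of a w] by (simp add: mult_free_group carrier_free_group)
  then show ?case
    using gen[OF x w Cons.IH[OF w]] inv[OF x w Cons.IH[OF w]]
    by (cases b) (simp_all add: a inv_gen[OF x])
qed (use assms(2) in simp)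

text \<open>The homomorphism from the universal property of the free group.\<close>

definition free_ext :: "('b, 'c) monoid_scheme \<Rightarrow> ('a \<Rightarrow> 'b) \<Rightarrow> 'a word \<Rightarrow> 'b" where
  "free_ext G \<sigma> w =
     foldr (\<lambda>(x, b) y. (if b then inv\<^bsub>G\<^esub> \<sigma> x else \<sigma> x) \<otimes>\<^bsub>G\<^esub> y) w \<one>\<^bsub>G\<^esub>"

lemma (in group) free_ext_closed:
  "\<sigma> \<in> S \<rightarrow> carrier G \<Longrightarrow> fst ` set w \<subseteq> S \<Longrightarrow> free_ext G \<sigma> w \<in> carrier G"
  by (induction w) (auto simp: free_ext_def Pi_def)

lemma (in group) free_ext_push:
  assumes \<sigma>: "\<sigma> \<in> S \<rightarrow> carrier G" and "fst a \<in> S" "fst ` set w \<subseteq> S"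
  shows "free_ext G \<sigma> (push_letter a w) = free_ext G \<sigma> (a # w)"
proof (cases "w \<noteq> [] \<and> hd w = inv_letter a")
  case True
  then obtain v where v: "w = inv_letter a # v" by (cases w) auto
  have "free_ext G \<sigma> v \<in> carrier G" "\<sigma> (fst a) \<in> carrier G"
    using assms by (auto simp: v intro!: free_ext_closed[OF \<sigma>])
  then show ?thesis
    by (cases a) (simp add: v push_letter_def free_ext_def inv_letter_def m_assoc[symmetric])
qed (auto simp: push_letter_def)

lemma (in group) free_ext_hom:
  assumes \<sigma>: "\<sigma> \<in> S \<rightarrow> carrier G"
  shows "free_ext G \<sigma> \<in> hom (free_group S) G"
proof (rule homI)
  fix u v assume "u \<in> carrier (free_group S)" and "v \<in> carrier (free_group S)"
  then have "fst ` set u \<subseteq> S" and v: "fst ` set v \<subseteq> S"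
    by (auto simp: carrier_free_group)
  then show "free_ext G \<sigma> (u \<otimes>\<^bsub>free_group S\<^esub> v) = free_ext G \<sigma> u \<otimes> free_ext G \<sigma> v"
    unfolding mult_free_group
  proof (induction u)
    case Nil
    then show ?case
      using free_ext_closed[OF \<sigma>] by (simp add: free_ext_def)
  next
    case (Cons a u)
    have a: "fst a \<in> S" and u: "fst ` set u \<subseteq> S" using Cons.prems by auto
    have uv: "fst ` set (foldr push_letter u v) \<subseteq> S"
      using letters_foldr_push[of u v] u v by blast
    have "free_ext G \<sigma> (foldr push_letter (a # u) v) =
        free_ext G \<sigma> (a # foldr push_letter u v)"
      using free_ext_push[OF \<sigma> a uv] by simp
    then show ?case
      using Cons.IH[OF u v] a \<sigma> free_ext_closed[OF \<sigma> u] free_ext_closed[OF \<sigma> v]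
      by (auto simp: free_ext_def case_prod_unfold m_assoc Pi_def)
  qed
qed (auto simp: carrier_free_group intro!: free_ext_closed[OF \<sigma>])

lemma (in group) free_ext_gen: "\<sigma> x \<in> carrier G \<Longrightarrow> free_ext G \<sigma> (gen x) = \<sigma> x"
  by (simp add: free_ext_def)

lemma free_group_hom_eqI:
  assumes "group G" "f \<in> hom (free_group S) G" "g \<in> hom (free_group S) G"
    and "\<And>x. x \<in> S \<Longrightarrow> f (gen x) = g (gen x)" and "w \<in> carrier (free_group S)"
  shows "f w = g w"
proof -
  interpret F: group "free_group S" by (rule group_free_group)
  interpret G: group G by fact
  interpret f: group_hom "free_group S" G f using assms(2) by unfold_locales
  interpret g: group_hom "free_group S" G g using assms(3) by unfold_locales
  show ?thesis
    using assms(5)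
  proof (induction rule: free_group_induct)
    case one
    then show ?case using f.hom_one g.hom_one by simp
  qed (simp_all add: gen_in_free_group assms(4))
qed

section \<open>The action on Fox derivatives\<close>

text \<open>All generators but \<open>0\<close> are specialized to \<open>1\<close>, and \<open>0\<close> to \<open>1 + X\<close>; \<open>fox j\<close> is the
  specialization of the Fox derivative with respect to the generator \<open>j\<close>.\<close>

definition letter_eps :: "nat \<times> bool \<Rightarrow> rat fps" where
  "letter_eps a = (if fst a = 0 then if snd a then inverse (1 + fps_X) else 1 + fps_X else 1)"

definition letter_fox :: "nat \<Rightarrow> nat \<times> bool \<Rightarrow> rat fps" where
  "letter_fox j a = (if fst a = j then if snd a then - letter_eps a else 1 else 0)"

primrec eps :: "nat word \<Rightarrow> rat fps" where
  "eps [] = 1"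
| "eps (a # w) = letter_eps a * eps w"

primrec fox :: "nat \<Rightarrow> nat word \<Rightarrow> rat fps" where
  "fox j [] = 0"
| "fox j (a # w) = letter_fox j a + letter_eps a * fox j w"

lemma inverse_1_plus_X: "(1 + fps_X) * inverse (1 + fps_X) = (1 :: rat fps)"
  "inverse (1 + fps_X) * (1 + fps_X) = (1 :: rat fps)"
  by (rule inverse_mult_eq_1' inverse_mult_eq_1; simp)+

lemma letter_eps_inv: "letter_eps a * letter_eps (inv_letter a) = 1"
  by (auto simp: letter_eps_def inv_letter_def inverse_1_plus_X)

text \<open>This is the product rule for a a^-1 = 1; it forces the derivative -x^-1 of an inverse
  letter.\<close>

lemma letter_fox_inv: "letter_fox j a + letter_eps a * letter_fox j (inv_letter a) = 0"
  by (auto simp: letter_fox_def letter_eps_def inv_letter_def inverse_1_plus_X)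

lemma eps_push: "eps (push_letter a w) = eps (a # w)"
  using letter_eps_inv[of a]
  by (cases w) (auto simp: push_letter_def mult.assoc[symmetric])

text \<open>A cancelled pair has derivative 0 and specializes to 1, so free reduction leaves the
  value unchanged.\<close>

lemma fox_push: "fox j (push_letter a w) = fox j (a # w)"
proof (cases "w \<noteq> [] \<and> hd w = inv_letter a")
  case True
  then obtain v where v: "w = inv_letter a # v" by (cases w) auto
  have "letter_fox j a + letter_eps a * (letter_fox j (inv_letter a) +
      letter_eps (inv_letter a) * fox j v) =
    (letter_fox j a + letter_eps a * letter_fox j (inv_letter a)) +
      (letter_eps a * letter_eps (inv_letter a)) * fox j v"
    by (simp add: algebra_simps)
  then show ?thesis
    by (simp add: v push_letter_def letter_eps_inv letter_fox_inv)
qed (auto simp: push_letter_def)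

lemma eps_mult: "eps (u \<otimes>\<^bsub>free_group S\<^esub> v) = eps u * eps v"
  unfolding mult_free_group by (induction u) (simp_all add: eps_push mult.assoc)

text \<open>The product rule of Fox calculus: \<open>fox j\<close> is a crossed homomorphism for the
  action through \<open>eps\<close>.\<close>

lemma fox_mult: "fox j (u \<otimes>\<^bsub>free_group S\<^esub> v) = fox j u + eps u * fox j v"
  unfolding mult_free_group by (induction u) (simp_all add: fox_push algebra_simps)

lemma eps_nth_0: "fps_nth (eps w) 0 = 1"
  by (induction w) (auto simp: letter_eps_def)

lemma eps_inv:
  assumes "w \<in> carrier (free_group S)"
  shows "eps (inv\<^bsub>free_group S\<^esub> w) * eps w = 1"
  using group.l_inv[OF group_free_group assms] eps_mult[of S "inv\<^bsub>free_group S\<^esub> w" w] by simp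

lemma fox_inv:
  assumes "w \<in> carrier (free_group S)"
  shows "fox j (inv\<^bsub>free_group S\<^esub> w) = - (eps (inv\<^bsub>free_group S\<^esub> w) * fox j w)"
  using group.l_inv[OF group_free_group assms] fox_mult[of j S "inv\<^bsub>free_group S\<^esub> w" w]
  by (simp add: eq_neg_iff_add_eq_0)

lemma eps_derived:
  assumes "w \<in> derived (free_group S) (carrier (free_group S))"
  shows "eps w = 1"
proof -
  \<comment> \<open>The unit group of the power series ring, an abelian target for
    \<open>eps\<close>.\<close>
  define H :: "rat fps monoid" where "H = \<lparr>carrier = {a. fps_nth a 0 \<noteq> 0}, monoid.mult = (*), one = 1\<rparr>"
  have "comm_group H"
  proof (rule comm_groupI)
    fix x assume "x \<in> carrier H"
    then show "\<exists>y\<in>carrier H. y \<otimes>\<^bsub>H\<^esub> x = \<one>\<^bsub>H\<^esub>"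
      by (intro bexI[of _ "inverse x"]) (auto simp: H_def inverse_mult_eq_1)
  qed (auto simp: H_def)
  moreover have "eps \<in> hom (free_group S) H"
    by (auto simp: hom_def H_def eps_mult eps_nth_0)
  ultimately show ?thesis
    using group.hom_comm_group_derived[OF group_free_group _ _ assms] by (fastforce simp: H_def)
qed

text \<open>As \<open>eps\<close> has constant term 1, the product rule becomes additivity at X = 0:
  the constant term is the exponent sum of the generator j.\<close>

lemma fox_derived_nth_0:
  assumes "w \<in> derived (free_group S) (carrier (free_group S))"
  shows "fps_nth (fox j w) 0 = 0"
proof -
  have "(\<lambda>w. fps_nth (fox j w) 0) \<in> hom (free_group S) rat_group"
    by (auto simp: hom_def rat_group_def fox_mult eps_nth_0)
  from group.hom_comm_group_derived[OF group_free_group comm_group_rat_group this assms]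
  show ?thesis by (simp add: rat_group_def)
qed

lemma fps_X_dvd_iff: "fps_X dvd a \<longleftrightarrow> fps_nth a 0 = (0 :: 'a :: comm_ring_1)"
proof
  assume "fps_nth a 0 = 0"
  then have "a = fps_X * Abs_fps (\<lambda>i. fps_nth a (Suc i))"
    by (intro fps_ext) simp
  then show "fps_X dvd a" by (metis dvd_triv_left)
qed (auto elim!: dvdE)

section \<open>Automorphisms in IA_n and the chain rule\<close>

lemma mult_IA:
  assumes "\<phi> \<in> carrier (IA n)" "\<psi> \<in> carrier (IA n)"
  shows "\<phi> \<otimes>\<^bsub>IA n\<^esub> \<psi> = (\<lambda>x \<in> carrier (FG n). \<phi> (\<psi> x))"
proof -
  have "\<phi> \<otimes>\<^bsub>IA n\<^esub> \<psi> = \<phi> \<otimes>\<^bsub>AutoGroup (FG n)\<^esub> \<psi>"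
    by (simp add: IA_def)
  then show ?thesis
    using assms by (simp add: carrier_IA mult_AutoGroup)
qed

lemma one_IA: "x \<in> carrier (FG n) \<Longrightarrow> \<one>\<^bsub>IA n\<^esub> x = x"
  by (simp add: IA_def AutoGroup_def BijGroup_def)

lemma IA_hom: "\<phi> \<in> carrier (IA n) \<Longrightarrow> \<phi> \<in> hom (FG n) (FG n)"
  by (simp add: carrier_IA auto_def)

lemma IA_derived_coset:
  assumes "\<phi> \<in> carrier (IA n)" "w \<in> carrier (FG n)"
  shows "\<exists>k \<in> derived (FG n) (carrier (FG n)). \<phi> w = k \<otimes>\<^bsub>FG n\<^esub> w"
proof -
  interpret F: group "FG n" by (rule group_free_group)
  let ?C = "derived (FG n) (carrier (FG n)) #>\<^bsub>FG n\<^esub> w"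
  have "?C \<in> carrier (abelianization (FG n))"
    using assms(2) by (auto simp: abelianization_def FactGroup_def RCOSETS_def)
  then have "\<phi> ` ?C = ?C"
    using assms(1) by (simp add: carrier_IA)
  moreover have "w \<in> ?C"
    using assms(2) by (intro F.rcos_self F.derived_is_subgroup subset_refl)
  ultimately have "\<phi> w \<in> ?C" by blast
  then show ?thesis unfolding r_coset_def by blast
qed

lemma eps_IA:
  assumes "\<phi> \<in> carrier (IA n)" "w \<in> carrier (FG n)"
  shows "eps (\<phi> w) = eps w"
  using IA_derived_coset[OF assms] eps_derived by (auto simp: eps_mult)

lemma fox_IA_nth_0:
  assumes "\<phi> \<in> carrier (IA n)" "w \<in> carrier (FG n)"
  shows "fps_nth (fox j (\<phi> w)) 0 = fps_nth (fox j w) 0"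
  using IA_derived_coset[OF assms] fox_derived_nth_0 eps_derived by (auto simp: fox_mult)

lemma fox_gen: "fox i (gen j) = (if i = j then 1 else 0)"
  by (simp add: letter_fox_def)

text \<open>In the general chain rule \<phi> is applied to the derivatives of w. Since \<phi>
  preserves \<open>eps\<close>, it disappears from them under the specialization, and plain matrix
  multiplication results.\<close>

lemma fox_chain_rule:
  assumes \<phi>: "\<phi> \<in> carrier (IA n)" and w: "w \<in> carrier (FG n)"
  shows "fox i (\<phi> w) = (\<Sum>k<n. fox i (\<phi> (gen k)) * fox k w)"
proof -
  interpret F: group "FG n" by (rule group_free_group)
  interpret h: group_hom "FG n" "FG n" \<phi>
    using IA_hom[OF \<phi>] by unfold_locales
  note simps = fox_mult eps_mult eps_IA[OF \<phi>] distrib_left sum.distrib sum_distrib_left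
    mult.left_commute[of "eps _"]
  show ?thesis
    using w
  proof (induction rule: free_group_induct)
    case one
    then show ?case using h.hom_one by simp
  next
    case (gen x w)
    then have "x \<in> {..<n}" "gen x \<in> carrier (FG n)" by (simp_all add: gen_in_free_group)
    with gen show ?case
      by (simp add: simps fox_gen if_distrib[of "(*) _"] sum.delta' del: fox.simps eps.simps cong: if_cong)
  next
    case (inv x w)
    then have x: "x \<in> {..<n}" "gen x \<in> carrier (FG n)" by (simp_all add: gen_in_free_group)
    have "eps (inv\<^bsub>FG n\<^esub> \<phi> (gen x)) = eps (inv\<^bsub>FG n\<^esub> gen x)"
      using eps_IA[OF \<phi> F.inv_closed[OF x(2)]] x by simp
    with inv x show ?case
      by (simp add: simps fox_inv mult.commute[of "eps _" "fox _ _"] fox_gen if_distrib[of "(*) _"] if_distrib[of uminus]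
          sum.delta' del: fox.simps eps.simps cong: if_cong)
  qed
qed

text \<open>The Jacobian of an automorphism, minus the identity matrix.\<close>

definition jac :: "(nat word \<Rightarrow> nat word) \<Rightarrow> nat \<Rightarrow> nat \<Rightarrow> rat fps" where
  "jac \<phi> i j = fox i (\<phi> (gen j)) - (if i = j then 1 else 0)"

text \<open>Jacobians multiply as matrices by the chain rule; subtracting the identity turns (1 +
  P)(1 + Q) into P + Q + PQ.\<close>

lemma jac_mult:
  assumes \<phi>: "\<phi> \<in> carrier (IA n)" and \<psi>: "\<psi> \<in> carrier (IA n)" and ij: "i < n" "j < n"
  shows "jac (\<phi> \<otimes>\<^bsub>IA n\<^esub> \<psi>) i j = jac \<phi> i j + jac \<psi> i j + (\<Sum>k<n. jac \<phi> i k * jac \<psi> k j)"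
proof -
  have j: "gen j \<in> carrier (FG n)" using ij by (simp add: gen_in_free_group)
  have \<psi>j: "\<psi> (gen j) \<in> carrier (FG n)" using hom_in_carrier[OF IA_hom[OF \<psi>] j] .
  have "fox i ((\<phi> \<otimes>\<^bsub>IA n\<^esub> \<psi>) (gen j)) = (\<Sum>k<n. fox i (\<phi> (gen k)) * fox k (\<psi> (gen j)))"
    using j by (simp add: mult_IA[OF \<phi> \<psi>] fox_chain_rule[OF \<phi> \<psi>j])
  also have "\<dots> = (\<Sum>k<n. (jac \<phi> i k + (if i = k then 1 else 0)) * (jac \<psi> k j + (if k = j then 1 else 0)))"
    by (simp add: jac_def)
  also have "\<dots> = (\<Sum>k<n. jac \<phi> i k * jac \<psi> k j + (if k = j then jac \<phi> i k else 0)
      + (if i = k then jac \<psi> k j else 0) + (if i = k then if k = j then 1 else 0 else 0))"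
    by (intro sum.cong refl) (simp add: algebra_simps)
  also have "\<dots> = (\<Sum>k<n. jac \<phi> i k * jac \<psi> k j) + jac \<phi> i j + jac \<psi> i j + (if i = j then 1 else 0)"
    using ij by (simp add: sum.distrib sum.delta sum.delta')
  finally show ?thesis by (simp add: jac_def)
qed

lemma jac_one: "j < n \<Longrightarrow> jac \<one>\<^bsub>IA n\<^esub> i j = 0"
  by (simp add: jac_def one_IA gen_in_free_group fox_gen del: fox.simps)

text \<open>IA_n preserves exponent sums, so the Jacobian is the identity at X = 0.\<close>

lemma fps_X_dvd_jac:
  assumes "\<phi> \<in> carrier (IA n)" "j < n"
  shows "fps_X dvd jac \<phi> i j"
proof -
  have "gen j \<in> carrier (FG n)" using assms by (simp add: gen_in_free_group)
  from fox_IA_nth_0[OF assms(1) this] show ?thesis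
    by (simp add: fps_X_dvd_iff jac_def fox_gen del: fox.simps)
qed

section \<open>The congruence filtration and the lower central series\<close>

definition congruence_level :: "nat \<Rightarrow> nat \<Rightarrow> (nat word \<Rightarrow> nat word) \<Rightarrow> bool" where
  "congruence_level n s \<phi> \<longleftrightarrow> (\<forall>i<n. \<forall>j<n. fps_X ^ s dvd jac \<phi> i j)"

lemma congruence_levelD: "congruence_level n s \<phi> \<Longrightarrow> i < n \<Longrightarrow> j < n \<Longrightarrow> fps_X ^ s dvd jac \<phi> i j"
  by (simp add: congruence_level_def)

lemma jac_product_dvd:
  assumes "congruence_level n s \<phi>" "congruence_level n r \<psi>" "i < n" "j < n"
  shows "fps_X ^ (s + r) dvd (\<Sum>k<n. jac \<phi> i k * jac \<psi> k j)"
  using assms by (intro dvd_sum) (auto simp: power_add intro!: mult_dvd_mono congruence_levelD)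

lemma congruence_level_mult:
  assumes \<phi>: "\<phi> \<in> carrier (IA n)" "congruence_level n s \<phi>"
    and \<psi>: "\<psi> \<in> carrier (IA n)" "congruence_level n s \<psi>"
  shows "congruence_level n s (\<phi> \<otimes>\<^bsub>IA n\<^esub> \<psi>)"
  unfolding congruence_level_def
proof (intro allI impI)
  fix i j assume ij: "i < n" "j < n"
  have "fps_X ^ s dvd (\<Sum>k<n. jac \<phi> i k * jac \<psi> k j)"
    using jac_product_dvd[OF \<phi>(2) \<psi>(2) ij] by (metis power_add dvd_mult_left)
  then show "fps_X ^ s dvd jac (\<phi> \<otimes>\<^bsub>IA n\<^esub> \<psi>) i j"
    unfolding jac_mult[OF \<phi>(1) \<psi>(1) ij] using \<phi>(2) \<psi>(2) ij
    by (intro dvd_add congruence_levelD)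
qed

text \<open>From (1 + P)(1 + Q) = 1 follows Q = -(P + PQ), and both terms inherit divisibility from
  P.\<close>

lemma congruence_level_inv:
  assumes \<phi>: "\<phi> \<in> carrier (IA n)" "congruence_level n s \<phi>"
  shows "congruence_level n s (inv\<^bsub>IA n\<^esub> \<phi>)"
  unfolding congruence_level_def
proof (intro allI impI)
  interpret I: group "IA n" by (rule group_IA)
  fix i j assume ij: "i < n" "j < n"
  let ?\<psi> = "inv\<^bsub>IA n\<^esub> \<phi>"
  have "jac \<phi> i j + jac ?\<psi> i j + (\<Sum>k<n. jac \<phi> i k * jac ?\<psi> k j) = 0"
    using jac_mult[OF \<phi>(1) I.inv_closed[OF \<phi>(1)] ij] \<phi>(1) jac_one[OF ij(2)] by simp
  then have "jac ?\<psi> i j = - (jac \<phi> i j + (\<Sum>k<n. jac \<phi> i k * jac ?\<psi> k j))"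
    unfolding eq_neg_iff_add_eq_0 by (simp only: ac_simps)
  moreover have "fps_X ^ s dvd (\<Sum>k<n. jac \<phi> i k * jac ?\<psi> k j)"
    using \<phi>(2) ij by (intro dvd_sum dvd_mult2 congruence_levelD) auto
  ultimately show "fps_X ^ s dvd jac ?\<psi> i j"
    using congruence_levelD[OF \<phi>(2) ij] by simp
qed

lemma commutator_mult_swap:
  assumes "group G" "x \<in> carrier G" "y \<in> carrier G"
  shows "commutator G x y \<otimes>\<^bsub>G\<^esub> (y \<otimes>\<^bsub>G\<^esub> x) = x \<otimes>\<^bsub>G\<^esub> y"
  using group.mult_eq_commutator_mult[OF assms] by (simp add: commutator_def)

text \<open>Writing \<open>1 + P\<close>, \<open>1 + Q\<close>, \<open>1 + Z\<close> for the Jacobians of \<open>\<phi>\<close>, \<open>\<psi>\<close> and their commutator, this is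
  \<open>Z = PQ - QP - Z (P + Q + QP)\<close>, which avoids inverse matrices.\<close>

lemma jac_commutator:
  assumes \<phi>: "\<phi> \<in> carrier (IA n)" and \<psi>: "\<psi> \<in> carrier (IA n)" and ij: "i < n" "j < n"
  shows "jac (commutator (IA n) \<phi> \<psi>) i j =
    (\<Sum>k<n. jac \<phi> i k * jac \<psi> k j) - (\<Sum>k<n. jac \<psi> i k * jac \<phi> k j)
      - (\<Sum>k<n. jac (commutator (IA n) \<phi> \<psi>) i k * jac (\<psi> \<otimes>\<^bsub>IA n\<^esub> \<phi>) k j)"
proof -
  interpret I: group "IA n" by (rule group_IA)
  let ?z = "commutator (IA n) \<phi> \<psi>"
  have z: "?z \<in> carrier (IA n)" using \<phi> \<psi> by (simp add: commutator_def)
  have "jac (\<phi> \<otimes>\<^bsub>IA n\<^esub> \<psi>) i j = jac ?z i j + jac (\<psi> \<otimes>\<^bsub>IA n\<^esub> \<phi>) i j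
      + (\<Sum>k<n. jac ?z i k * jac (\<psi> \<otimes>\<^bsub>IA n\<^esub> \<phi>) k j)"
    using jac_mult[OF z I.m_closed[OF \<psi> \<phi>] ij] commutator_mult_swap[OF group_IA \<phi> \<psi>] by simp
  then show ?thesis
    using jac_mult[OF \<phi> \<psi> ij] jac_mult[OF \<psi> \<phi> ij] by (simp add: algebra_simps)
qed

text \<open>PQ and QP are divisible by X^(s+1). The remaining term in the formula for Z is Z times a
  matrix divisible by X, so each induction step gains one power of X for Z until the bound s + 1 is
  reached.\<close>

lemma congruence_level_commutator:
  assumes \<phi>: "\<phi> \<in> carrier (IA n)" "congruence_level n s \<phi>" and \<psi>: "\<psi> \<in> carrier (IA n)"
  shows "congruence_level n (Suc s) (commutator (IA n) \<phi> \<psi>)"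
proof -
  interpret I: group "IA n" by (rule group_IA)
  let ?z = "commutator (IA n) \<phi> \<psi>"
  have one: "congruence_level n 1 \<theta>" if "\<theta> \<in> carrier (IA n)" for \<theta>
    using that by (simp add: congruence_level_def fps_X_dvd_jac)
  have "congruence_level n m ?z" if "m \<le> Suc s" for m
    using that
  proof (induction m)
    case (Suc m)
    have "fps_X ^ Suc m dvd jac ?z i j" if ij: "i < n" "j < n" for i j
      unfolding jac_commutator[OF \<phi>(1) \<psi> ij]
    proof (intro dvd_diff)
      have "fps_X ^ Suc m dvd (fps_X ^ Suc s :: rat fps)"
        using Suc.prems by (rule le_imp_power_dvd)
      moreover have "fps_X ^ Suc s dvd (\<Sum>k<n. jac \<phi> i k * jac \<psi> k j)"
        using jac_product_dvd[OF \<phi>(2) one[OF \<psi>] ij] by simp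
      moreover have "fps_X ^ Suc s dvd (\<Sum>k<n. jac \<psi> i k * jac \<phi> k j)"
        using jac_product_dvd[OF one[OF \<psi>] \<phi>(2) ij] by simp
      ultimately show "fps_X ^ Suc m dvd (\<Sum>k<n. jac \<phi> i k * jac \<psi> k j)"
        "fps_X ^ Suc m dvd (\<Sum>k<n. jac \<psi> i k * jac \<phi> k j)"
        using dvd_trans by blast+
      have "congruence_level n m ?z" using Suc by simp
      from jac_product_dvd[OF this one[OF I.m_closed[OF \<psi> \<phi>(1)]] ij]
      show "fps_X ^ Suc m dvd (\<Sum>k<n. jac ?z i k * jac (\<psi> \<otimes>\<^bsub>IA n\<^esub> \<phi>) k j)"
        by simp
    qed
    then show ?case by (simp add: congruence_level_def)
  qed (simp add: congruence_level_def)
  then show ?thesis by simp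
qed

lemma lower_central_IA_congruence_level:
  "\<phi> \<in> lower_central (IA n) (Suc s) \<Longrightarrow> congruence_level n (Suc s) \<phi>"
proof (induction s arbitrary: \<phi>)
  case 0
  then show ?case by (simp add: congruence_level_def fps_X_dvd_jac)
next
  case (Suc s)
  interpret I: group "IA n" by (rule group_IA)
  let ?N = "{\<phi> \<in> carrier (IA n). congruence_level n (Suc (Suc s)) \<phi>}"
  have "subgroup ?N (IA n)"
  proof (rule I.subgroupI)
    show "?N \<noteq> {}"
      using jac_one I.one_closed by (auto simp: congruence_level_def)
  qed (auto intro: congruence_level_mult congruence_level_inv)
  moreover have "commutator (IA n) x y \<in> ?N"
    if "x \<in> lower_central (IA n) (Suc s)" "y \<in> carrier (IA n)" for x y
    using congruence_level_commutator[OF _ Suc.IH[OF that(1)] that(2)]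
      subsetD[OF I.lower_central_carrier that(1)] I.commutator_closed that(2) by blast
  ultimately have "lower_central (IA n) (Suc (Suc s)) \<subseteq> ?N"
    unfolding lower_central.simps(3)
    by (intro I.generate_subgroup_incl) (auto simp: commutator_def)
  with Suc.prems show ?case by blast
qed

section \<open>Two automorphisms\<close>

text \<open>Being mutually inverse and acting trivially on the abelianization are both equalities of
  homomorphisms out of a free group, so generators suffice.\<close>

lemma IA_I:
  assumes \<phi>: "\<phi> \<in> hom (FG n) (FG n)" and \<psi>: "\<psi> \<in> hom (FG n) (FG n)"
    and inv: "\<And>x. x < n \<Longrightarrow> \<phi> (\<psi> (gen x)) = gen x" "\<And>x. x < n \<Longrightarrow> \<psi> (\<phi> (gen x)) = gen x"
    and coset: "\<And>x. x < n \<Longrightarrow> \<exists>k \<in> derived (FG n) (carrier (FG n)). \<phi> (gen x) = k \<otimes>\<^bsub>FG n\<^esub> gen x"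
      "\<And>x. x < n \<Longrightarrow> \<exists>k \<in> derived (FG n) (carrier (FG n)). \<psi> (gen x) = k \<otimes>\<^bsub>FG n\<^esub> gen x"
  shows "restrict \<phi> (carrier (FG n)) \<in> carrier (IA n)"
proof -
  interpret F: group "FG n" by (rule group_free_group)
  let ?F = "carrier (FG n)" and ?D = "derived (FG n) (carrier (FG n))"
  interpret D: normal ?D "FG n" by (rule F.derived_self_is_normal)
  have id: "(\<lambda>w. w) \<in> hom (FG n) (FG n)" by (auto simp: hom_def)
  have cancel: "\<alpha> (\<beta> w) = w"
    if "\<alpha> \<in> hom (FG n) (FG n)" "\<beta> \<in> hom (FG n) (FG n)" "\<And>x. x < n \<Longrightarrow> \<alpha> (\<beta> (gen x)) = gen x" "w \<in> ?F"
    for \<alpha> \<beta> w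
    using free_group_hom_eqI[OF group_free_group hom_compose[OF that(2,1)] id _ that(4)] that(3)
    by simp
  note c1 = cancel[OF \<phi> \<psi> inv(1)] and c2 = cancel[OF \<psi> \<phi> inv(2)]
  have coset_eq: "?D #>\<^bsub>FG n\<^esub> \<alpha> w = ?D #>\<^bsub>FG n\<^esub> w"
    if \<alpha>: "\<alpha> \<in> hom (FG n) (FG n)" and
      gens: "\<And>x. x < n \<Longrightarrow> \<exists>k \<in> ?D. \<alpha> (gen x) = k \<otimes>\<^bsub>FG n\<^esub> gen x" and w: "w \<in> ?F" for \<alpha> w
  proof -
    have "((\<lambda>w. ?D #>\<^bsub>FG n\<^esub> w) \<circ> \<alpha>) w = ?D #>\<^bsub>FG n\<^esub> w"
    proof (rule free_group_hom_eqI[OF D.factorgroup_is_group _ D.r_coset_hom_Mod _ w])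
      show "(\<lambda>w. ?D #>\<^bsub>FG n\<^esub> w) \<circ> \<alpha> \<in> hom (FG n) (FG n Mod ?D)"
        by (rule hom_compose[OF \<alpha> D.r_coset_hom_Mod])
      fix x assume "x \<in> {..<n}"
      then have x: "gen x \<in> ?F" "x < n" by (simp_all add: gen_in_free_group)
      obtain k where k: "k \<in> ?D" "\<alpha> (gen x) = k \<otimes>\<^bsub>FG n\<^esub> gen x"
        using gens[OF x(2)] by blast
      have "?D #>\<^bsub>FG n\<^esub> (k \<otimes>\<^bsub>FG n\<^esub> gen x) = ?D #>\<^bsub>FG n\<^esub> k #>\<^bsub>FG n\<^esub> gen x"
        using k(1) x(1) D.subset by (intro F.coset_mult_assoc[symmetric]) auto
      also have "?D #>\<^bsub>FG n\<^esub> k = ?D" by (rule D.rcos_const[OF F.group_axioms k(1)])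
      finally show "((\<lambda>w. ?D #>\<^bsub>FG n\<^esub> w) \<circ> \<alpha>) (gen x) = ?D #>\<^bsub>FG n\<^esub> gen x"
        by (simp add: k(2))
    qed
    then show ?thesis by simp
  qed
  have stable: "\<alpha> w \<in> C" if \<alpha>: "\<alpha> \<in> hom (FG n) (FG n)"
      and gens: "\<And>x. x < n \<Longrightarrow> \<exists>k \<in> ?D. \<alpha> (gen x) = k \<otimes>\<^bsub>FG n\<^esub> gen x"
      and C: "C \<in> carrier (abelianization (FG n))" and wC: "w \<in> C" for \<alpha> w C
  proof -
    obtain x where x: "x \<in> ?F" "C = ?D #>\<^bsub>FG n\<^esub> x"
      using C by (auto simp: abelianization_def FactGroup_def RCOSETS_def)
    have w: "w \<in> ?F"
      using wC x F.r_coset_subset_G[OF D.subset x(1)] by blast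
    have "\<alpha> w \<in> ?D #>\<^bsub>FG n\<^esub> \<alpha> w"
      using hom_in_carrier[OF \<alpha> w] by (intro F.rcos_self D.subgroup_axioms)
    also have "\<dots> = ?D #>\<^bsub>FG n\<^esub> w" by (rule coset_eq[OF \<alpha> gens w])
    also have "\<dots> = C"
      unfolding x(2) using wC x by (intro F.repr_independence[symmetric] D.subgroup_axioms) auto
    finally show ?thesis .
  qed
  have "bij_betw \<phi> ?F ?F"
    by (rule bij_betw_byWitness[where f' = \<psi>])
      (use c1 c2 hom_in_carrier[OF \<phi>] hom_in_carrier[OF \<psi>] in auto)
  then have "restrict \<phi> ?F \<in> Bij ?F"
    by (simp add: Bij_def)
  moreover have "restrict \<phi> ?F \<in> hom (FG n) (FG n)"
    using \<phi> by (auto simp: hom_def Pi_def)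
  moreover have "restrict \<phi> ?F ` C = C" if C: "C \<in> carrier (abelianization (FG n))" for C
  proof -
    have sub: "C \<subseteq> ?F"
      using C F.r_coset_subset_G[OF D.subset]
      by (auto simp: abelianization_def FactGroup_def RCOSETS_def)
    then have "restrict \<phi> ?F ` C = \<phi> ` C" by (intro image_cong) auto
    also have "\<dots> = C"
    proof
      show "\<phi> ` C \<subseteq> C" using stable[OF \<phi> coset(1) C] by blast
      show "C \<subseteq> \<phi> ` C"
      proof
        fix w assume w: "w \<in> C"
        \<comment> \<open>\<psi> preserves the coset as well, so it supplies a preimage inside
          it.\<close>
        then have "w = \<phi> (\<psi> w)" using c1 sub by auto
        with stable[OF \<psi> coset(2) C w] show "w \<in> \<phi> ` C" by blast
      qed
    qed
    finally show ?thesis .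
  qed
  ultimately show ?thesis
    by (simp add: carrier_IA auto_def)
qed

section \<open>Automorphisms moving one generator\<close>

definition basis_change :: "nat \<Rightarrow> nat \<Rightarrow> nat word \<Rightarrow> nat word \<Rightarrow> nat word" where
  "basis_change n a v =
     restrict (free_ext (FG n) (\<lambda>x. if x = a then v else gen x)) (carrier (FG n))"

text \<open>\<open>v'\<close> is the image of the generator under the inverse map; \<open>k\<close>
  and \<open>k'\<close> witness that both maps are trivial modulo commutators.\<close>

lemma basis_change_in_IA:
  assumes a: "a < n" and v: "v \<in> carrier (FG n)" "v' \<in> carrier (FG n)"
    and inv: "free_ext (FG n) (\<lambda>x. if x = a then v else gen x) v' = gen a"
      "free_ext (FG n) (\<lambda>x. if x = a then v' else gen x) v = gen a"
    and k: "k \<in> derived (FG n) (carrier (FG n))" "v = k \<otimes>\<^bsub>FG n\<^esub> gen a"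
      "k' \<in> derived (FG n) (carrier (FG n))" "v' = k' \<otimes>\<^bsub>FG n\<^esub> gen a"
  shows "basis_change n a v \<in> carrier (IA n)"
proof -
  interpret F: group "FG n" by (rule group_free_group)
  interpret D: normal "derived (FG n) (carrier (FG n))" "FG n" by (rule F.derived_self_is_normal)
  let ?\<sigma> = "\<lambda>v x. if x = a then v else gen x"
  have \<sigma>: "?\<sigma> v \<in> {..<n} \<rightarrow> carrier (FG n)" if "v \<in> carrier (FG n)" for v
    using that by (auto simp: gen_in_free_group)
  have gen: "free_ext (FG n) (?\<sigma> v) (gen x) = ?\<sigma> v x" if "v \<in> carrier (FG n)" "x < n" for v x
    using that by (intro F.free_ext_gen) (auto simp: gen_in_free_group)
  have triv: "\<exists>k \<in> derived (FG n) (carrier (FG n)). gen x = k \<otimes>\<^bsub>FG n\<^esub> gen x" if "x < n" for x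
    using that D.one_closed F.l_one[of "gen x"] by (auto simp: gen_in_free_group)
  show ?thesis
    unfolding basis_change_def
  proof (rule IA_I[where \<psi> = "free_ext (FG n) (?\<sigma> v')"])
    show "free_ext (FG n) (?\<sigma> v) \<in> hom (FG n) (FG n)" "free_ext (FG n) (?\<sigma> v') \<in> hom (FG n) (FG n)"
      by (intro F.free_ext_hom \<sigma> v)+
    fix x assume x: "x < n"
    show "free_ext (FG n) (?\<sigma> v) (free_ext (FG n) (?\<sigma> v') (gen x)) = gen x"
      using inv(1) gen[OF v(1) x] unfolding gen[OF v(2) x] by auto
    show "free_ext (FG n) (?\<sigma> v') (free_ext (FG n) (?\<sigma> v) (gen x)) = gen x"
      using inv(2) gen[OF v(2) x] unfolding gen[OF v(1) x] by auto
    show "\<exists>k \<in> derived (FG n) (carrier (FG n)). free_ext (FG n) (?\<sigma> v) (gen x) = k \<otimes>\<^bsub>FG n\<^esub> gen x"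
      "\<exists>k \<in> derived (FG n) (carrier (FG n)). free_ext (FG n) (?\<sigma> v') (gen x) = k \<otimes>\<^bsub>FG n\<^esub> gen x"
      unfolding gen[OF v(1) x] gen[OF v(2) x] using k triv[OF x] by auto
  qed
qed

lemma jac_basis_change:
  assumes "v \<in> carrier (FG n)" "j < n"
  shows "jac (basis_change n a v) i j =
    (if j = a then fox i v - (if i = a then 1 else 0) else 0)"
proof -
  have "free_ext (FG n) (\<lambda>x. if x = a then v else gen x) (gen j) = (if j = a then v else gen j)"
    by (rule group.free_ext_gen[OF group_free_group]) (use assms in \<open>auto simp: gen_in_free_group\<close>)
  then show ?thesis
    using assms(2)
    by (auto simp: jac_def basis_change_def gen_in_free_group fox_gen simp del: fox.simps)
qed

lemmas word_computation = free_ext_def mult_free_group push_letter_def inv_letter_def inv_gen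

lemma commutator_in_derived:
  "x \<in> carrier G \<Longrightarrow> y \<in> carrier G \<Longrightarrow> commutator G x y \<in> derived G (carrier G)"
  unfolding commutator_def derived_def by (intro generate.incl) blast

definition auto_u :: "nat \<Rightarrow> nat word \<Rightarrow> nat word" where
  "auto_u n = basis_change n 2 [(0, False), (1, False), (0, True), (1, True), (2, False)]"

definition auto_d :: "nat \<Rightarrow> nat word \<Rightarrow> nat word" where
  "auto_d n = basis_change n 1 [(0, False), (1, False), (0, True)]"

lemma inv_inv_gen: "x \<in> S \<Longrightarrow> inv\<^bsub>free_group S\<^esub> [(x, True)] = gen x"
  by (metis gen_in_free_group group.inv_inv group_free_group inv_gen)

lemma auto_u_in_IA:
  assumes "n \<ge> 3" shows "auto_u n \<in> carrier (IA n)"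
  unfolding auto_u_def
\<comment> \<open>The inverse multiplies by [x_1, x_0] = [x_0, x_1]^-1.\<close>
proof (rule basis_change_in_IA[where k = "commutator (FG n) (gen 0) (gen 1)"
      and k' = "commutator (FG n) (gen 1) (gen 0)"
      and v' = "[(1, False), (0, False), (1, True), (0, True), (2, False)]"])
  show "commutator (FG n) (gen 0) (gen 1) \<in> derived (FG n) (carrier (FG n))"
    "commutator (FG n) (gen 1) (gen 0) \<in> derived (FG n) (carrier (FG n))"
    using assms by (auto intro!: commutator_in_derived simp: gen_in_free_group)
qed (use assms in \<open>auto simp: carrier_free_group commutator_def word_computation\<close>)

lemma auto_d_in_IA:
  assumes "n \<ge> 3" shows "auto_d n \<in> carrier (IA n)"
  unfolding auto_d_def
\<comment> \<open>Here x_0 x_1 x_0^-1 = [x_0, x_1] x_1, and the inverse conjugation gives x_0^-1 x_1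
  x_0 = [x_0^-1, x_1] x_1.\<close>
proof (rule basis_change_in_IA[where k = "commutator (FG n) (gen 0) (gen 1)"
      and k' = "commutator (FG n) [(0, True)] (gen 1)"
      and v' = "[(0, True), (1, False), (0, False)]"])
  show "commutator (FG n) (gen 0) (gen 1) \<in> derived (FG n) (carrier (FG n))"
    "commutator (FG n) [(0, True)] (gen 1) \<in> derived (FG n) (carrier (FG n))"
    using assms by (auto intro!: commutator_in_derived simp: gen_in_free_group)
qed (use assms in \<open>auto simp: carrier_free_group commutator_def word_computation inv_inv_gen\<close>)

lemma cancel_1_plus_X: "(1 + fps_X) * (inverse (1 + fps_X) * a) = (a :: rat fps)"
  by (simp add: mult.assoc[symmetric] inverse_1_plus_X)

text \<open>The derivatives of [x_0, x_1] x_2 by x_0, x_1, x_2 are 1 - x_0 x_1 x_0^-1, x_0 -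
  [x_0, x_1] and [x_0, x_1], which specialize to 0, X and 1.\<close>

lemma jac_auto_u:
  assumes "n \<ge> 3" "j < n"
  shows "jac (auto_u n) i j = (if i = 1 \<and> j = 2 then fps_X else 0)"
proof -
  have "[(0, False), (1, False), (0, True), (1, True), (2, False)] \<in> carrier (FG n)"
    using assms(1) by (auto simp: carrier_free_group inv_letter_def)
  from jac_basis_change[OF this assms(2)] show ?thesis
    by (auto simp: auto_u_def letter_fox_def letter_eps_def inverse_1_plus_X
        cancel_1_plus_X distrib_left right_diff_distrib)
qed

text \<open>The derivatives of x_0 x_1 x_0^-1 by x_0 and x_1 are 1 - x_0 x_1 x_0^-1 and x_0, which
  specialize to 0 and 1 + X.\<close>

lemma jac_auto_d:
  assumes "n \<ge> 3" "j < n"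
  shows "jac (auto_d n) i j = (if i = 1 \<and> j = 1 then fps_X else 0)"
proof -
  have "[(0, False), (1, False), (0, True)] \<in> carrier (FG n)"
    using assms(1) by (auto simp: carrier_free_group inv_letter_def)
  from jac_basis_change[OF this assms(2)] show ?thesis
    by (auto simp: auto_d_def letter_fox_def letter_eps_def inverse_1_plus_X
        cancel_1_plus_X distrib_left right_diff_distrib)
qed

lemma sum_single_index:
  assumes "k < (n :: nat)" "\<And>i. i < n \<Longrightarrow> i \<noteq> k \<Longrightarrow> f i = 0"
  shows "(\<Sum>i<n. f i) = (f k :: 'a :: comm_monoid_add)"
  using sum.mono_neutral_right[of "{..<n}" "{k}" f] assms by auto

text \<open>The matrices of \<open>auto_u\<close> and \<open>auto_d\<close> are \<open>1 + X E\<^sub>1\<^sub>2\<close> and \<open>1 + X E\<^sub>1\<^sub>1\<close>; taking the commutator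
  with the latter multiplies the entry in position \<open>(1, 2)\<close> by \<open>- X\<close>.\<close>

lemma jac_iterated_commutator:
  assumes n: "n \<ge> 3" and "i < n" "j < n"
  shows "jac (iterated_commutator (IA n) (auto_u n) (auto_d n) s) i j =
    (if i = 1 \<and> j = 2 then fps_X * (- fps_X) ^ s else 0)"
  using assms(2,3)
proof (induction s arbitrary: i j)
  case 0
  then show ?case by (simp add: jac_auto_u[OF n])
next
  case (Suc s)
  interpret I: group "IA n" by (rule group_IA)
  note u = auto_u_in_IA[OF n] and d = auto_d_in_IA[OF n]
  let ?g = "iterated_commutator (IA n) (auto_u n) (auto_d n) s"
  let ?d = "auto_d n" and ?p = "fps_X * (- fps_X) ^ s :: rat fps"
  let ?z = "commutator (IA n) ?g ?d"
  have g: "?g \<in> carrier (IA n)"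
    using I.iterated_commutator_in_lower_central[OF u d] I.lower_central_carrier by blast
  \<comment> \<open>E_12 E_11 = 0, whereas E_11 E_12 = E_12 gives the next product.\<close>
  have gd: "(\<Sum>k<n. jac ?g i k * jac ?d k j) = 0" if "i < n" "j < n" for i j
    using that n by (intro sum.neutral) (simp add: Suc.IH jac_auto_d)
  have dg: "(\<Sum>k<n. jac ?d i k * jac ?g k j) = (if i = 1 \<and> j = 2 then fps_X * ?p else 0)"
    if "i < n" "j < n" for i j
  proof -
    have "(\<Sum>k<n. jac ?d i k * jac ?g k j) = jac ?d i 1 * jac ?g 1 j"
      using that n by (intro sum_single_index) (auto simp: jac_auto_d)
    then show ?thesis
      using that n by (simp add: Suc.IH jac_auto_d)
  qed
  have Q: "jac (?d \<otimes>\<^bsub>IA n\<^esub> ?g) i j = (if i = 1 \<and> j = 1 then fps_X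
      else if i = 1 \<and> j = 2 then ?p + fps_X * ?p else 0)" if "i < n" "j < n" for i j
    unfolding jac_mult[OF d g that] dg[OF that] using that by (simp add: Suc.IH jac_auto_d[OF n])
  \<comment> \<open>Only row 1 of the Jacobian of the reversed product differs from the identity, so
    the correction sum keeps one term, with column 1 of the unknown matrix.\<close>
  have z: "jac ?z i j = (if i = 1 \<and> j = 2 then - (fps_X * ?p) else 0)
      - jac ?z i 1 * (if j = 1 then fps_X else if j = 2 then ?p + fps_X * ?p else 0)"
    if ij: "i < n" "j < n" for i j
  proof -
    have "(\<Sum>k<n. jac ?z i k * jac (?d \<otimes>\<^bsub>IA n\<^esub> ?g) k j) =
        jac ?z i 1 * jac (?d \<otimes>\<^bsub>IA n\<^esub> ?g) 1 j"
      using ij n by (intro sum_single_index) (auto simp: Q)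
    then show ?thesis
      using jac_commutator[OF g d ij] ij n by (simp add: gd dg Q)
  qed
  \<comment> \<open>For column 1 the relation refers to itself and says that 1 + X annihilates the
    entry; power series over Q form a domain, so the entry is 0 and the correction drops
    out.\<close>
  have z1: "jac ?z i 1 = 0" if i: "i < n" for i
  proof -
    have "jac ?z i 1 * (1 + fps_X) = 0"
      using z[OF i, of 1] n by (simp add: distrib_left eq_neg_iff_add_eq_0)
    moreover have "(1 + fps_X :: rat fps) \<noteq> 0"
      using inverse_1_plus_X(1) by fastforce
    ultimately show ?thesis by (metis mult_eq_0_iff)
  qed
  show ?case
    using z[OF Suc.prems] z1[OF Suc.prems(1)] by simp
qed

section \<open>An expansion invariant under inner automorphisms\<close>

text \<open>Entry (1, 2) over entry (2, 2) of the Jacobian. For automorphisms in IA_n with n >= 3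
  the denominator has constant term 1, hence is a unit.\<close>

definition fox_ratio :: "(nat word \<Rightarrow> nat word) \<Rightarrow> rat fps" where
  "fox_ratio \<phi> = fox 1 (\<phi> (gen 2)) * inverse (fox 2 (\<phi> (gen 2)))"

lemma fox_ratio_jac: "fox_ratio \<phi> = jac \<phi> 1 2 * inverse (1 + jac \<phi> 2 2)"
  by (simp add: fox_ratio_def jac_def)

text \<open>The difference is -a b / (1 + b), of twice the order. Additivity of entry (1, 2) modulo
  that power therefore survives the division.\<close>

lemma fox_ratio_approx:
  assumes "fps_X ^ Suc s dvd a" "fps_X ^ Suc s dvd (b :: rat fps)"
  shows "fps_X ^ (2 * Suc s) dvd a * inverse (1 + b) - a"
proof -
  have "fps_nth b 0 = 0"
    using fps_X_power_dvd_nth_eq_0[OF assms(2)] by simp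
  then have "(1 + b) * inverse (1 + b) = 1"
    by (intro inverse_mult_eq_1') simp
  then have "a * inverse (1 + b) - a = a * (inverse (1 + b) - (1 + b) * inverse (1 + b))"
    by (simp add: algebra_simps)
  also have "\<dots> = a * b * - inverse (1 + b)"
    by (simp add: algebra_simps)
  finally have "a * inverse (1 + b) - a = a * b * - inverse (1 + b)" .
  moreover have "fps_X ^ (Suc s + Suc s) dvd a * b"
    unfolding power_add by (rule mult_dvd_mono[OF assms])
  ultimately show ?thesis
    by (simp only: mult_2 dvd_mult2)
qed

lemma central_expansion_IA:
  assumes n: "n \<ge> 3"
  shows "central_expansion (IA n) fox_ratio (auto_u n) (auto_d n)"
proof -
  interpret I: group "IA n" by (rule group_IA)
  have n2: "1 < n" "2 < n" using n by auto
  note D = congruence_levelD[OF lower_central_IA_congruence_level]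
  have approx: "fps_X ^ (2 * Suc s) dvd fox_ratio x - jac x 1 2"
    if "x \<in> lower_central (IA n) (Suc s)" for x s
    unfolding fox_ratio_jac by (rule fox_ratio_approx[OF D[OF that n2] D[OF that n2(2,2)]])
  show ?thesis
  proof
    fix x s assume x: "x \<in> lower_central (IA n) (Suc s)"
    show "fps_X ^ Suc s dvd fox_ratio x"
      unfolding fox_ratio_jac by (rule dvd_mult2[OF D[OF x n2]])
  next
    fix x y s assume x: "x \<in> lower_central (IA n) (Suc s)" and y: "y \<in> lower_central (IA n) (Suc s)"
    have c: "x \<in> carrier (IA n)" "y \<in> carrier (IA n)"
      using x y I.lower_central_carrier by blast+
    let ?xy = "x \<otimes>\<^bsub>IA n\<^esub> y"
    have xy: "?xy \<in> lower_central (IA n) (Suc s)"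
      using x y by (intro subgroup.m_closed[OF normal_imp_subgroup[OF I.lower_central_normal]])
    \<comment> \<open>The defect of additivity is an entry of PQ, where both factors are divisible
      by X^(s+1).\<close>
    have "fps_X ^ (2 * Suc s) dvd jac ?xy 1 2 - (jac x 1 2 + jac y 1 2)"
      using jac_product_dvd[OF lower_central_IA_congruence_level[OF x]
          lower_central_IA_congruence_level[OF y] n2]
      unfolding jac_mult[OF c n2] by (simp add: mult_2)
    from dvd_add[OF dvd_diff[OF dvd_diff[OF approx[OF xy] approx[OF x]] approx[OF y]] this]
    show "fps_X ^ (2 * Suc s) dvd fox_ratio ?xy - (fox_ratio x + fox_ratio y)"
      by (simp add: algebra_simps)
  next
    fix s
    have "fox_ratio (iterated_commutator (IA n) (auto_u n) (auto_d n) s) = fps_X * (- fps_X) ^ s"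
      using n2 by (simp add: fox_ratio_jac jac_iterated_commutator[OF n])
    also have "\<dots> = fps_const ((- 1) ^ s) * fps_X ^ Suc s"
      by (simp add: power_minus[of fps_X] fps_const_power[symmetric] fps_const_neg[symmetric]
          del: fps_const_neg fps_const_power)
    finally show "fps_nth (fox_ratio (iterated_commutator (IA n) (auto_u n) (auto_d n) s)) (Suc s) \<noteq> 0"
      by simp
  qed (intro auto_u_in_IA auto_d_in_IA n)+
qed

text \<open>The product rule gives D(g) + g D(w) - g w g^-1 D(g); when w specializes to 1, the outer
  terms cancel.\<close>

lemma fox_conj:
  assumes g: "g \<in> carrier (free_group S)" and w: "eps w = 1"
  shows "fox j (g \<otimes>\<^bsub>free_group S\<^esub> w \<otimes>\<^bsub>free_group S\<^esub> inv\<^bsub>free_group S\<^esub> g) = eps g * fox j w"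
proof -
  have "eps g * (eps (inv\<^bsub>free_group S\<^esub> g) * fox j g) = fox j g"
    using eps_inv[OF g] by (simp add: mult.assoc[symmetric] mult.commute)
  then show ?thesis
    by (simp add: fox_mult eps_mult w fox_inv[OF g])
qed

text \<open>The generator 2 specializes to 1, hence so does its image under \<phi>. Conjugation then
  multiplies both Fox derivatives by the unit \<open>eps g\<close>, which cancels in the
  ratio.\<close>

lemma fox_ratio_inner:
  assumes n: "n \<ge> 3" and c: "c \<in> Inn (FG n)" and \<phi>: "\<phi> \<in> carrier (IA n)"
  shows "fox_ratio (c \<otimes>\<^bsub>IA n\<^esub> \<phi>) = fox_ratio \<phi>"
proof -
  obtain g where g: "g \<in> carrier (FG n)" "c = conj_auto (FG n) g"
    using c by (auto simp: Inn_def)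
  have cI: "c \<in> carrier (IA n)" using c Inn_subset_IA by blast
  have gen: "gen 2 \<in> carrier (FG n)" using n by (simp add: gen_in_free_group)
  have \<phi>g: "\<phi> (gen 2) \<in> carrier (FG n)" using hom_in_carrier[OF IA_hom[OF \<phi>] gen] .
  have e: "eps (\<phi> (gen 2)) = 1"
    using eps_IA[OF \<phi> gen] by (simp add: letter_eps_def)
  have "(c \<otimes>\<^bsub>IA n\<^esub> \<phi>) (gen 2) = g \<otimes>\<^bsub>FG n\<^esub> \<phi> (gen 2) \<otimes>\<^bsub>FG n\<^esub> inv\<^bsub>FG n\<^esub> g"
    unfolding mult_IA[OF cI \<phi>] using gen \<phi>g by (simp add: g(2) conj_auto_def)
  then have "fox j ((c \<otimes>\<^bsub>IA n\<^esub> \<phi>) (gen 2)) = eps g * fox j (\<phi> (gen 2))" for j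
    using fox_conj[OF g(1) e] by simp
  then have "fox_ratio (c \<otimes>\<^bsub>IA n\<^esub> \<phi>) =
      (eps g * fox 1 (\<phi> (gen 2))) * inverse (eps g * fox 2 (\<phi> (gen 2)))"
    by (simp add: fox_ratio_def)
  also have "\<dots> = (eps g * inverse (eps g)) * fox_ratio \<phi>"
    by (simp only: fox_ratio_def fps_inverse_mult mult.assoc mult.left_commute)
  also have "eps g * inverse (eps g) = 1"
    by (intro inverse_mult_eq_1') (simp add: eps_nth_0)
  finally show ?thesis by simp
qed

text \<open>Members of a coset differ from \<phi> by an inner automorphism on the left, so any
  chosen representative has the same ratio and the expansion of IA_n descends.\<close>

lemma central_expansion_OA:
  assumes n: "n \<ge> 3"
  shows "central_expansion (OA n) (\<lambda>C. fox_ratio (SOME \<phi>. \<phi> \<in> C))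
    (Inn (FG n) #>\<^bsub>IA n\<^esub> auto_u n) (Inn (FG n) #>\<^bsub>IA n\<^esub> auto_d n)"
proof -
  interpret I: group "IA n" by (rule group_IA)
  have "IA n = (AutoGroup (FG n))\<lparr>carrier := carrier (IA n)\<rparr>"
    by (simp add: IA_def)
  moreover have "Inn (FG n) \<lhd> (AutoGroup (FG n))\<lparr>carrier := carrier (IA n)\<rparr>"
    by (intro group.normal_restrict_supergroup group.AutoGroup group.Inn_normal
        group_free_group subgroup_IA Inn_subset_IA)
  ultimately have "Inn (FG n) \<lhd> IA n" by metis
  then interpret N: normal "Inn (FG n)" "IA n" .
  let ?h = "\<lambda>\<phi>. Inn (FG n) #>\<^bsub>IA n\<^esub> \<phi>"
  show ?thesis
  proof (rule central_expansion.central_expansion_image[OF central_expansion_IA[OF n] group_OA])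
    show "?h \<in> hom (IA n) (OA n)"
      unfolding OA_def by (rule N.r_coset_hom_Mod)
    show "?h ` carrier (IA n) = carrier (OA n)"
      by (auto simp: OA_def FactGroup_def RCOSETS_def)
    fix \<phi> assume \<phi>: "\<phi> \<in> carrier (IA n)"
    have "\<phi> \<in> ?h \<phi>" by (rule I.rcos_self[OF \<phi> N.subgroup_axioms])
    then have "(SOME \<psi>. \<psi> \<in> ?h \<phi>) \<in> ?h \<phi>"
      by (rule someI[of "\<lambda>\<psi>. \<psi> \<in> ?h \<phi>"])
    then obtain c where "c \<in> Inn (FG n)" "(SOME \<psi>. \<psi> \<in> ?h \<phi>) = c \<otimes>\<^bsub>IA n\<^esub> \<phi>"
      unfolding r_coset_def by auto
    then show "fox_ratio (SOME \<psi>. \<psi> \<in> ?h \<phi>) = fox_ratio \<phi>"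
      using fox_ratio_inner[OF n _ \<phi>] by simp
  qed
qed

theorem theorem1p6:
  fixes n :: nat
  assumes "n \<ge> 3"
  shows "(\<not> vectorspace.fin_dim class_ring (rationalization (gr_lcs (IA n))) \<and>
          \<not> trivial_alexander_action_rat (IA n)) \<and>
         (\<not> vectorspace.fin_dim class_ring (rationalization (gr_lcs (OA n))) \<and>
          \<not> trivial_alexander_action_rat (OA n))"
  using central_expansion_IA[OF assms, THEN central_expansion.not_fin_dim_gr_lcs]
    central_expansion_IA[OF assms, THEN central_expansion.not_trivial_alexander_action_rat]
    central_expansion_OA[OF assms, THEN central_expansion.not_fin_dim_gr_lcs]
    central_expansion_OA[OF assms, THEN central_expansion.not_trivial_alexander_action_rat]
  by blast

end
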